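(* Let $T:=[T_1,\ldots,T_n]\in B(\mathcal{H})^n$ be an $n$-tuple of operators with joint spectral radius $r(T_1,\ldots,T_n)<1$ and let $U\in\mathcal{U}(H_n)$. Then $$\mathcal{C}_T(\beta_U(f))=\mathcal{C}_{\beta_U(T)}(f),\qquad f\in\mathcal{A}_n,$$ where $\beta_U$ is the canonical automorphism generated by $U$.
   Context: $\mathbb{F}_n^+$ is the unital free semigroup on generators $g_1,\ldots,g_n$ with identity $g_0$; $|\alpha|$ is word length; $\tilde\alpha:=g_{i_k}\cdots g_{i_1}$ is the reverse of $\alpha=g_{i_1}\cdots g_{i_k}$; $T_\alpha:=T_{i_1}\cdots T_{i_k}$, $T_{g_0}:=I$. The joint spectral radius is $r(T_1,\ldots,T_n):=\lim_{k\to\infty}\|\sum_{|\alpha|=k}T_\alpha T_\alpha^*\|^{1/2k}$. $F^2(H_n)=\mathbb{C}1\oplus\bigoplus_{m\ge1}H_n^{\otimes m}$ is the full Fock space, $H_n$ an $n$-dimensional Hilbert space with orthonormal basis $e_1,\ldots,e_n$; $S_i\xi:=e_i\otimes\xi$, $R_i\xi:=\xi\otimes e_i$. The noncommutative disc algebra $\mathcal{A}_n\subset B(F^2(H_n))$ is the norm closed algebra generated by $S_1,\ldots,S_n$ and the identity. The Cauchy kernel is $C_T(R_1,\ldots,R_n):=\sum_{k=0}^\infty\sum_{|\alpha|=k}R_\alpha\otimes T_{\tilde\alpha}^*$ (norm convergent when $r(T_1,\ldots,T_n)<1$), and the Cauchy transform $\mathcal{C}_T:B(F^2(H_n))\to B(\mathcal{H})$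 is defined by $\langle\mathcal{C}_T(A)x,y\rangle:=\langle(A\otimes I_{\mathcal{H}})(1\otimes x),C_T(R_1,\ldots,R_n)(1\otimes y)\rangle$, $x,y\in\mathcal{H}$. $\mathcal{U}(H_n)$ is the group of unitaries on $H_n$. For $U=[\lambda_{ij}]_{i,j=1}^n\in\mathcal{U}(H_n)$ and $T\in B(\mathcal{H})^n$, $\beta_U(T):=[\sum_{i=1}^n\lambda_{i1}T_i,\ldots,\sum_{i=1}^n\lambda_{in}T_i]$ (one has $r(\beta_U(T))=r(T)$). The symbol $\beta_U$ also denotes the unique completely isometric automorphism of $\mathcal{A}_n$ with $\beta_U(S_j)=\sum_{i=1}^n\lambda_{ij}S_i$, $j=1,\ldots,n$. *)

theory Defs
  imports "HOL-Analysis.Analysis"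
begin

section \<open>Complex Hilbert spaces\<close>

class scaleC =
  fixes scaleC :: "complex \<Rightarrow> 'a \<Rightarrow> 'a"  (infixr "*\<^sub>C" 75)

text \<open>The inner product is linear in the first and conjugate-linear in the second argument.
  Positive definiteness is contained in \<open>cinner_self\<close>, since the norm is already a norm.\<close>

class complex_inner = real_normed_vector + scaleC +
  fixes cinner :: "'a \<Rightarrow> 'a \<Rightarrow> complex"
  assumes scaleC_add_right: "c *\<^sub>C (x + y) = c *\<^sub>C x + c *\<^sub>C y"
    and scaleC_add_left: "(c + d) *\<^sub>C x = c *\<^sub>C x + d *\<^sub>C x"
    and scaleC_scaleC: "c *\<^sub>C (d *\<^sub>C x) = (c * d) *\<^sub>C x"
    and scaleC_of_real: "complex_of_real r *\<^sub>C x = r *\<^sub>R x"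
    and cinner_commute: "cinner x y = cnj (cinner y x)"
    and cinner_add_left: "cinner (x + y) z = cinner x z + cinner y z"
    and cinner_scaleC_left: "cinner (c *\<^sub>C x) y = c * cinner x y"
    and cinner_self: "cinner x x = complex_of_real ((norm x)\<^sup>2)"

class chilbert_space = complex_inner + complete_space

lemma cinner_add_right: "cinner (x :: 'a::complex_inner) (y + z) = cinner x y + cinner x z"
  by (metis cinner_add_left cinner_commute complex_cnj_add)

lemma cinner_scaleC_right: "cinner (x :: 'a::complex_inner) (c *\<^sub>C y) = cnj c * cinner x y"
  by (metis cinner_commute cinner_scaleC_left complex_cnj_mult)

lemma scaleC_one [simp]: "1 *\<^sub>C (x :: 'a::complex_inner) = x"
  using scaleC_of_real[of 1 x] by simp

lemma scaleC_zero_left [simp]: "0 *\<^sub>C (x :: 'a::complex_inner) = 0"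
  using scaleC_of_real[of 0 x] by simp

lemma scaleC_zero_right [simp]: "c *\<^sub>C (0 :: 'a::complex_inner) = 0"
  using scaleC_add_right[of c 0 "0::'a"] by simp

lemma cinner_zero_left [simp]: "cinner 0 (x :: 'a::complex_inner) = 0"
  using cinner_scaleC_left[of 0 x x] by simp

lemma cinner_zero_right [simp]: "cinner (x :: 'a::complex_inner) 0 = 0"
  using cinner_scaleC_right[of x 0 x] by simp

lemma norm_scaleC: "norm (c *\<^sub>C (x :: 'a::complex_inner)) = cmod c * norm x"
proof -
  have "complex_of_real ((norm (c *\<^sub>C x))\<^sup>2) = c * cnj c * complex_of_real ((norm x)\<^sup>2)"
    by (simp only: cinner_self[symmetric] cinner_scaleC_left cinner_scaleC_right ac_simps)
  also have "\<dots> = complex_of_real ((cmod c * norm x)\<^sup>2)"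
    by (simp add: complex_norm_square[symmetric] power_mult_distrib)
  finally have "(norm (c *\<^sub>C x))\<^sup>2 = (cmod c * norm x)\<^sup>2"
    using of_real_eq_iff by blast
  then show ?thesis
    by (simp add: power2_eq_iff_nonneg)
qed

lemma cauchy_schwarz: "cmod (cinner (x :: 'a::complex_inner) y) \<le> norm x * norm y"
proof (cases "y = 0")
  case True
  then show ?thesis by simp
next
  case False
  define n where "n = (norm y)\<^sup>2"
  have n: "n > 0" using False by (simp add: n_def)
  define a where "a = cinner x y"
  define c where "c = - (a / complex_of_real n)"
  have yx: "cinner y x = cnj a" unfolding a_def by (rule cinner_commute)
  have "complex_of_real ((norm (x + c *\<^sub>C y))\<^sup>2)
      = cinner x x + cnj c * a + c * cnj a + c * cnj c * complex_of_real n"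
    unfolding cinner_self[symmetric, of "x + c *\<^sub>C y"]
    by (simp add: cinner_add_left cinner_add_right cinner_scaleC_left cinner_scaleC_right yx
        cinner_self[of y] n_def a_def[symmetric] algebra_simps)
  also have "\<dots> = complex_of_real ((norm x)\<^sup>2) - a * cnj a / complex_of_real n"
    using n by (simp add: cinner_self c_def field_simps)
  also have "\<dots> = complex_of_real ((norm x)\<^sup>2 - (cmod a)\<^sup>2 / n)"
    by (simp add: complex_norm_square[symmetric])
  finally have "(norm (x + c *\<^sub>C y))\<^sup>2 = (norm x)\<^sup>2 - (cmod a)\<^sup>2 / n"
    using of_real_eq_iff by blast
  then have "(cmod a)\<^sup>2 / n \<le> (norm x)\<^sup>2"
    by (metis diff_ge_0_iff_ge zero_le_power2)
  then have "(cmod a)\<^sup>2 \<le> (norm x * norm y)\<^sup>2"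
    using n by (simp add: n_def field_simps power_mult_distrib)
  then show ?thesis
    unfolding a_def by (rule power2_le_imp_le) simp
qed

instantiation complex :: chilbert_space
begin
definition scaleC_complex :: "complex \<Rightarrow> complex \<Rightarrow> complex" where "scaleC_complex c x = c * x"
definition cinner_complex :: "complex \<Rightarrow> complex \<Rightarrow> complex" where "cinner_complex x y = x * cnj y"
instance
  by standard
    (auto simp: scaleC_complex_def cinner_complex_def algebra_simps scaleR_conv_of_real
      complex_norm_square[symmetric])
end


section \<open>Square-summable families\<close>

text \<open>\<open>('i, 'h) ell2\<close> is the Hilbert space direct sum of copies of \<open>'h\<close> indexed by \<open>'i\<close>.\<close>

typedef (overloaded) ('i, 'h) ell2 =
  "{f :: 'i \<Rightarrow> 'h::real_normed_vector. (\<lambda>i. (norm (f i))\<^sup>2) summable_on UNIV}"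
  morphisms ell2_coord Abs_ell2
  by (rule exI[of _ "\<lambda>_. 0"]) simp

setup_lifting type_definition_ell2

lemma sqsum_bound:
  fixes f :: "'i \<Rightarrow> 'h::real_normed_vector"
  assumes "\<And>F. finite F \<Longrightarrow> (\<Sum>i\<in>F. (norm (f i))\<^sup>2) \<le> M"
  shows "(\<lambda>i. (norm (f i))\<^sup>2) summable_on UNIV" "(\<Sum>\<^sub>\<infinity>i. (norm (f i))\<^sup>2) \<le> M"
proof -
  show *: "(\<lambda>i. (norm (f i))\<^sup>2) summable_on UNIV"
    by (rule nonneg_bdd_above_summable_on) (use assms in \<open>auto intro!: bdd_aboveI2\<close>)
  show "(\<Sum>\<^sub>\<infinity>i. (norm (f i))\<^sup>2) \<le> M"
    by (rule infsum_le_finite_sums[OF *]) (use assms in auto)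
qed

lemma L2_set_sq: "(L2_set f F)\<^sup>2 = (\<Sum>i\<in>F. (f i)\<^sup>2)"
  by (simp add: L2_set_def sum_nonneg)

lemma L2_bound:
  fixes f :: "'i \<Rightarrow> 'h::real_normed_vector"
  assumes "\<And>F. finite F \<Longrightarrow> L2_set (\<lambda>i. norm (f i)) F \<le> M"
  shows "(\<lambda>i. (norm (f i))\<^sup>2) summable_on UNIV" "sqrt (\<Sum>\<^sub>\<infinity>i. (norm (f i))\<^sup>2) \<le> M"
proof -
  have M: "0 \<le> M" using assms[of "{}"] by simp
  have *: "(\<Sum>i\<in>F. (norm (f i))\<^sup>2) \<le> M\<^sup>2" if "finite F" for F
    using assms[OF that] by (metis L2_set_nonneg L2_set_sq power_mono)
  show "(\<lambda>i. (norm (f i))\<^sup>2) summable_on UNIV"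
    using sqsum_bound(1)[OF *] .
  show "sqrt (\<Sum>\<^sub>\<infinity>i. (norm (f i))\<^sup>2) \<le> M"
    using sqsum_bound(2)[OF *] M real_le_lsqrt by (simp add: real_sqrt_le_iff real_le_lsqrt infsum_nonneg)
qed

lemma L2_le:
  fixes f :: "'i \<Rightarrow> 'h::real_normed_vector"
  assumes "(\<lambda>i. (norm (f i))\<^sup>2) summable_on UNIV" "finite F"
  shows "L2_set (\<lambda>i. norm (f i)) F \<le> sqrt (\<Sum>\<^sub>\<infinity>i. (norm (f i))\<^sup>2)"
  unfolding L2_set_def
  by (intro real_sqrt_le_mono finite_sum_le_infsum assms) auto

lemma L2_add_le:
  fixes f g :: "'i \<Rightarrow> 'h::real_normed_vector"
  assumes "(\<lambda>i. (norm (f i))\<^sup>2) summable_on UNIV" "(\<lambda>i. (norm (g i))\<^sup>2) summable_on UNIV" "finite F"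
  shows "L2_set (\<lambda>i. norm (f i + g i)) F
    \<le> sqrt (\<Sum>\<^sub>\<infinity>i. (norm (f i))\<^sup>2) + sqrt (\<Sum>\<^sub>\<infinity>i. (norm (g i))\<^sup>2)"
proof -
  have "L2_set (\<lambda>i. norm (f i + g i)) F \<le> L2_set (\<lambda>i. norm (f i) + norm (g i)) F"
    by (rule L2_set_mono) (auto simp: norm_triangle_ineq)
  also have "\<dots> \<le> L2_set (\<lambda>i. norm (f i)) F + L2_set (\<lambda>i. norm (g i)) F"
    by (rule L2_set_triangle_ineq)
  finally show ?thesis
    using L2_le[OF assms(1,3)] L2_le[OF assms(2,3)] by linarith
qed

instantiation ell2 :: (type, real_normed_vector) real_vector
begin

lift_definition zero_ell2 :: "('a, 'b) ell2" is "\<lambda>_. 0" by simp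
lift_definition plus_ell2 :: "('a, 'b) ell2 \<Rightarrow> ('a, 'b) ell2 \<Rightarrow> ('a, 'b) ell2"
  is "\<lambda>f g i. f i + g i"
  by (auto intro: L2_bound(1) L2_add_le)
lift_definition uminus_ell2 :: "('a, 'b) ell2 \<Rightarrow> ('a, 'b) ell2" is "\<lambda>f i. - f i" by simp
lift_definition minus_ell2 :: "('a, 'b) ell2 \<Rightarrow> ('a, 'b) ell2 \<Rightarrow> ('a, 'b) ell2"
  is "\<lambda>f g i. f i - g i"
  subgoal for f g using L2_bound(1)[OF L2_add_le[of f "\<lambda>i. - g i"]] by auto
  done
lift_definition scaleR_ell2 :: "real \<Rightarrow> ('a, 'b) ell2 \<Rightarrow> ('a, 'b) ell2" is "\<lambda>r f i. r *\<^sub>R f i"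
  by (auto simp: power_mult_distrib intro: summable_on_cmult_right)
instance
proof
  fix f g h :: "('a, 'b) ell2" and r s :: real
  show "f + g + h = f + (g + h)" by transfer (simp add: add.assoc)
  show "f + g = g + f" by transfer (simp add: add.commute)
  show "0 + f = f" by transfer simp
  show "- f + f = 0" by transfer simp
  show "f - g = f + - g" by transfer simp
  show "r *\<^sub>R (f + g) = r *\<^sub>R f + r *\<^sub>R g" by transfer (simp add: scaleR_add_right)
  show "(r + s) *\<^sub>R f = r *\<^sub>R f + s *\<^sub>R f" by transfer (simp add: scaleR_add_left)
  show "r *\<^sub>R s *\<^sub>R f = (r * s) *\<^sub>R f" by transfer simp
  show "1 *\<^sub>R f = f" by transfer simp
qed

end

instantiation ell2 :: (type, real_normed_vector) real_normed_vector
begin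

lift_definition norm_ell2 :: "('a, 'b) ell2 \<Rightarrow> real" is "\<lambda>f. sqrt (\<Sum>\<^sub>\<infinity>i. (norm (f i))\<^sup>2)" .

definition dist_ell2 :: "('a, 'b) ell2 \<Rightarrow> ('a, 'b) ell2 \<Rightarrow> real"
  where "dist_ell2 f g = norm (f - g)"
definition sgn_ell2 :: "('a, 'b) ell2 \<Rightarrow> ('a, 'b) ell2"
  where "sgn_ell2 f = f /\<^sub>R norm f"
definition uniformity_ell2 :: "(('a, 'b) ell2 \<times> ('a, 'b) ell2) filter"
  where "uniformity_ell2 = (INF e\<in>{0 <..}. principal {(x, y). dist x y < e})"
definition open_ell2 :: "('a, 'b) ell2 set \<Rightarrow> bool"
  where "open_ell2 S = (\<forall>x\<in>S. \<forall>\<^sub>F (x', y) in uniformity. x' = x \<longrightarrow> y \<in> S)"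

instance
proof
  fix f g :: "('a, 'b) ell2" and r :: real and S :: "('a, 'b) ell2 set"
  show "dist f g = norm (f - g)" by (rule dist_ell2_def)
  show "sgn f = f /\<^sub>R norm f" by (rule sgn_ell2_def)
  show "uniformity = (INF e\<in>{0 <..}. principal {(x, y :: ('a, 'b) ell2). dist x y < e})"
    by (rule uniformity_ell2_def)
  show "open S = (\<forall>x\<in>S. \<forall>\<^sub>F (x', y) in uniformity. x' = x \<longrightarrow> y \<in> S)"
    by (rule open_ell2_def)
  show "norm f = 0 \<longleftrightarrow> f = 0"
  proof
    assume "norm f = 0"
    then have "ell2_coord f i = 0" for i
      using L2_le[of "ell2_coord f" "{i}"] ell2_coord[of f] by (simp add: norm_ell2.rep_eq L2_set_def)
    then show "f = 0"
      by (simp add: ell2_coord_inject[symmetric] zero_ell2.rep_eq fun_eq_iff)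
  next
    assume "f = 0"
    then show "norm f = 0" by transfer simp
  qed
  show "norm (f + g) \<le> norm f + norm g"
    by transfer (auto intro: L2_bound(2) L2_add_le)
  show "norm (r *\<^sub>R f) = \<bar>r\<bar> * norm f"
    by transfer (simp add: power_mult_distrib infsum_cmult_right' real_sqrt_mult)
qed

end

lemma norm_ell2_le:
  assumes "\<And>F. finite F \<Longrightarrow> L2_set (\<lambda>i. norm (ell2_coord f i)) F \<le> M"
  shows "norm f \<le> M"
  using assms by transfer (rule L2_bound(2))

lemma L2_coord_le: "finite F \<Longrightarrow> L2_set (\<lambda>i. norm (ell2_coord f i)) F \<le> norm f"
  by transfer (auto intro: L2_le)

lemma norm_coord_le: "norm (ell2_coord f i) \<le> norm f"
  using L2_coord_le[of "{i}" f] by (simp add: L2_set_def)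

lemma norm_ell2_sq: "(norm f)\<^sup>2 = (\<Sum>\<^sub>\<infinity>i. (norm (ell2_coord f i))\<^sup>2)"
  by transfer (simp add: infsum_nonneg)

lemma cinner_summable:
  fixes f g :: "'i \<Rightarrow> 'h::complex_inner"
  assumes "(\<lambda>i. (norm (f i))\<^sup>2) summable_on UNIV" "(\<lambda>i. (norm (g i))\<^sup>2) summable_on UNIV"
  shows "(\<lambda>i. cinner (f i) (g i)) summable_on UNIV"
proof (rule abs_summable_summable, rule summable_on_comparison_test)
  show "(\<lambda>i. (norm (f i))\<^sup>2 + (norm (g i))\<^sup>2) summable_on UNIV"
    by (intro summable_on_add assms)
  fix i
  have "cmod (cinner (f i) (g i)) \<le> norm (f i) * norm (g i)" by (rule cauchy_schwarz)
  also have "\<dots> \<le> (norm (f i))\<^sup>2 + (norm (g i))\<^sup>2"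
    using sum_squares_bound[of "norm (f i)" "norm (g i)"] mult_nonneg_nonneg[of "norm (f i)" "norm (g i)"]
    by (simp del: mult_nonneg_nonneg)
  finally show "cmod (cinner (f i) (g i)) \<le> (norm (f i))\<^sup>2 + (norm (g i))\<^sup>2" .
qed auto

instantiation ell2 :: (type, complex_inner) complex_inner
begin

lift_definition scaleC_ell2 :: "complex \<Rightarrow> ('a, 'b) ell2 \<Rightarrow> ('a, 'b) ell2" is "\<lambda>c f i. c *\<^sub>C f i"
  by (auto simp: norm_scaleC power_mult_distrib intro: summable_on_cmult_right)
lift_definition cinner_ell2 :: "('a, 'b) ell2 \<Rightarrow> ('a, 'b) ell2 \<Rightarrow> complex"
  is "\<lambda>f g. \<Sum>\<^sub>\<infinity>i. cinner (f i) (g i)" .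

instance
proof
  fix f g h :: "('a, 'b) ell2" and c d :: complex and r :: real
  show "c *\<^sub>C (f + g) = c *\<^sub>C f + c *\<^sub>C g" by transfer (simp add: scaleC_add_right)
  show "(c + d) *\<^sub>C f = c *\<^sub>C f + d *\<^sub>C f" by transfer (simp add: scaleC_add_left)
  show "c *\<^sub>C d *\<^sub>C f = (c * d) *\<^sub>C f" by transfer (simp add: scaleC_scaleC)
  show "complex_of_real r *\<^sub>C f = r *\<^sub>R f" by transfer (simp add: scaleC_of_real)
  show "cinner f g = cnj (cinner g f)"
    by transfer (subst infsum_cnj[symmetric], simp add: cinner_commute[symmetric])
  show "cinner (f + g) h = cinner f h + cinner g h"
    by transfer (simp add: cinner_add_left infsum_add cinner_summable)
  show "cinner (c *\<^sub>C f) g = c * cinner f g"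
    by transfer (simp add: cinner_scaleC_left infsum_cmult_right')
  show "cinner f f = complex_of_real ((norm f)\<^sup>2)"
    by transfer (auto simp: cinner_self infsum_nonneg has_sum_of_real_iff has_sum_infsum
        simp del: of_real_power intro!: infsumI)
qed

end

instance ell2 :: (type, chilbert_space) chilbert_space
proof
  fix X :: "nat \<Rightarrow> ('a, 'b) ell2"
  assume X: "Cauchy X"
  have coord_diff: "ell2_coord (f - g) i = ell2_coord f i - ell2_coord g i"
    for f g :: "('a, 'b) ell2" and i by transfer simp
  have "Cauchy (\<lambda>n. ell2_coord (X n) i)" for i
  proof (rule metric_CauchyI)
    fix e :: real assume "e > 0"
    then obtain N where N: "\<And>m n. m \<ge> N \<Longrightarrow> n \<ge> N \<Longrightarrow> dist (X m) (X n) < e"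
      using metric_CauchyD[OF X] by blast
    have "dist (ell2_coord (X m) i) (ell2_coord (X n) i) < e" if "m \<ge> N" "n \<ge> N" for m n
      using N[OF that] norm_coord_le[of "X m - X n" i] by (simp add: dist_norm coord_diff)
    then show "\<exists>M. \<forall>m\<ge>M. \<forall>n\<ge>M. dist (ell2_coord (X m) i) (ell2_coord (X n) i) < e" by blast
  qed
  then have "\<forall>i. \<exists>l. (\<lambda>n. ell2_coord (X n) i) \<longlonglongrightarrow> l"
    using Cauchy_convergent unfolding convergent_def by blast
  then obtain g where g: "\<And>i. (\<lambda>n. ell2_coord (X n) i) \<longlonglongrightarrow> g i"
    by metis
  have tail: "L2_set (\<lambda>i. norm (ell2_coord (X n) i - g i)) F \<le> e"
    if "\<And>m. m \<ge> N \<Longrightarrow> dist (X n) (X m) < e" "finite F" for N n e F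
  proof (rule tendsto_upperbound)
    show "(\<lambda>m. L2_set (\<lambda>i. norm (ell2_coord (X n) i - ell2_coord (X m) i)) F)
        \<longlonglongrightarrow> L2_set (\<lambda>i. norm (ell2_coord (X n) i - g i)) F"
      unfolding L2_set_def by (intro tendsto_intros g)
    show "\<forall>\<^sub>F m in sequentially. L2_set (\<lambda>i. norm (ell2_coord (X n) i - ell2_coord (X m) i)) F \<le> e"
      unfolding eventually_sequentially
    proof (intro exI allI impI)
      fix m assume "m \<ge> N"
      then show "L2_set (\<lambda>i. norm (ell2_coord (X n) i - ell2_coord (X m) i)) F \<le> e"
        using L2_coord_le[OF that(2), of "X n - X m"] that(1)[of m] by (simp add: dist_norm coord_diff)
    qed
  qed simp
  obtain N1 where N1: "\<And>m n. m \<ge> N1 \<Longrightarrow> n \<ge> N1 \<Longrightarrow> dist (X m) (X n) < 1"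
    using metric_CauchyD[OF X, of 1] by auto
  have "(\<lambda>i. (norm (ell2_coord (X N1) i - g i))\<^sup>2) summable_on UNIV"
    by (rule L2_bound(1)[where M = 1]) (rule tail[of N1 N1], auto intro: N1)
  moreover have "(\<lambda>i. (norm (ell2_coord (X N1) i))\<^sup>2) summable_on UNIV"
    using ell2_coord by auto
  ultimately have "(\<lambda>i. (norm (ell2_coord (X N1) i + - (ell2_coord (X N1) i - g i)))\<^sup>2) summable_on UNIV"
    by (intro L2_bound(1)[OF L2_add_le]) (auto simp: norm_minus_commute)
  then have "(\<lambda>i. (norm (g i))\<^sup>2) summable_on UNIV" by simp
  then obtain G where G: "ell2_coord G = g"
    using Abs_ell2_inverse[of g] by auto
  have "X \<longlonglongrightarrow> G"
  proof (rule metric_LIMSEQ_I)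
    fix e :: real assume "e > 0"
    then obtain N where N: "\<And>m n. m \<ge> N \<Longrightarrow> n \<ge> N \<Longrightarrow> dist (X m) (X n) < e / 2"
      using metric_CauchyD[OF X, of "e / 2"] by auto
    have "dist (X n) G < e" if "n \<ge> N" for n
    proof -
      have "norm (X n - G) \<le> e / 2"
        using tail[of N n "e / 2"] N[OF that] by (intro norm_ell2_le) (simp add: coord_diff G)
      then show ?thesis using \<open>e > 0\<close> by (simp add: dist_norm)
    qed
    then show "\<exists>N. \<forall>n\<ge>N. dist (X n) G < e" by blast
  qed
  then show "convergent X" by (auto simp: convergent_def)
qed


section \<open>Bounded operators\<close>

text \<open>\<open>'a \<Rightarrow>\<^sub>L 'b\<close> is the type of bounded real-linear maps; \<open>B(H)\<close> is its
  subset of complex-linear maps, with the inherited (operator) norm and composition.\<close>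

definition bounded_ops :: "('a::complex_inner \<Rightarrow>\<^sub>L 'b::complex_inner) set" where
  "bounded_ops = {A. \<forall>c x. blinfun_apply A (c *\<^sub>C x) = c *\<^sub>C blinfun_apply A x}"

lemma bounded_linear_scaleC: "bounded_linear (\<lambda>x::'a::complex_inner. c *\<^sub>C x)"
proof (rule bounded_linear_intro[where K = "cmod c"])
  fix r and x :: 'a
  show "c *\<^sub>C r *\<^sub>R x = r *\<^sub>R c *\<^sub>C x"
    by (metis scaleC_of_real scaleC_scaleC mult.commute)
qed (auto simp: scaleC_add_right norm_scaleC)

instantiation blinfun :: (real_normed_vector, complex_inner) scaleC
begin
lift_definition scaleC_blinfun :: "complex \<Rightarrow> 'a \<Rightarrow>\<^sub>L 'b \<Rightarrow> 'a \<Rightarrow>\<^sub>L 'b" is "\<lambda>c A x. c *\<^sub>C A x"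
  by (rule bounded_linear_compose[OF bounded_linear_scaleC])
instance ..
end

definition adj :: "'a::complex_inner \<Rightarrow>\<^sub>L 'b::complex_inner \<Rightarrow> 'b \<Rightarrow>\<^sub>L 'a" where
  "adj A = (THE B. \<forall>x y. cinner (blinfun_apply A x) y = cinner x (blinfun_apply B y))"

text \<open>Words over \<open>'n\<close> (i.e. \<open>'n list\<close>, with the empty word as identity) form the free
  semigroup on \<open>n = CARD('n)\<close> generators; word reversal is \<^const>\<open>rev\<close>.\<close>

fun op_word :: "('n \<Rightarrow> 'a::real_normed_vector \<Rightarrow>\<^sub>L 'a) \<Rightarrow> 'n list \<Rightarrow> 'a \<Rightarrow>\<^sub>L 'a" where
  "op_word T [] = id_blinfun"
| "op_word T (i # \<alpha>) = T i o\<^sub>L op_word T \<alpha>"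

definition joint_spectral_radius :: "('n::finite \<Rightarrow> 'h::complex_inner \<Rightarrow>\<^sub>L 'h) \<Rightarrow> real" where
  "joint_spectral_radius T =
    lim (\<lambda>k. norm (\<Sum>\<alpha> | length \<alpha> = k. op_word T \<alpha> o\<^sub>L adj (op_word T \<alpha>)) powr (1 / (2 * real k)))"


section \<open>Full Fock space\<close>

text \<open>\<open>H\<^sub>n\<close> is \<open>complex ^ 'n\<close> with its standard basis, and \<open>H\<^sub>n\<^sup>\<otimes>\<^sup>m\<close> consists of the families of
  coefficients indexed by the words of length \<open>m\<close>, with respect to the orthonormal basis of elementary
  tensors of basis vectors. Their Hilbert space direct sum over all \<open>m\<close> is the full Fock space; the
  summand for \<open>m = 0\<close>, indexed by the empty word, is spanned by the vacuum vector.\<close>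

type_synonym 'n fock = "('n list, complex) ell2"

lift_definition vacuum :: "'n fock" is "\<lambda>\<alpha>. if \<alpha> = [] then 1 else 0"
proof -
  have "(\<lambda>\<alpha>::'n list. (cmod (if \<alpha> = [] then 1 else 0))\<^sup>2) summable_on UNIV \<longleftrightarrow>
      (\<lambda>\<alpha>::'n list. (cmod (if \<alpha> = [] then 1 else 0))\<^sup>2) summable_on {[]}"
    by (rule summable_on_cong_neutral) auto
  then show "(\<lambda>\<alpha>::'n list. (cmod (if \<alpha> = [] then 1 else 0))\<^sup>2) summable_on UNIV" by simp
qed

lemma word_sum_bound:
  fixes \<xi> :: "'n::finite fock" and v :: "complex ^ 'n"
  assumes inj: "inj_on (\<lambda>\<alpha>. (a \<alpha>, b \<alpha>)) (- {[]})" and F: "finite F"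
  shows "L2_set (\<lambda>\<alpha>. cmod (if \<alpha> = [] then 0 else v $ a \<alpha> * ell2_coord \<xi> (b \<alpha>))) F \<le> norm v * norm \<xi>"
proof -
  let ?G = "F - {[]}"
  have "(\<Sum>\<alpha>\<in>F. (cmod (if \<alpha> = [] then 0 else v $ a \<alpha> * ell2_coord \<xi> (b \<alpha>)))\<^sup>2)
      = (\<Sum>\<alpha>\<in>?G. (cmod (v $ a \<alpha>))\<^sup>2 * (cmod (ell2_coord \<xi> (b \<alpha>)))\<^sup>2)"
    by (rule sum.mono_neutral_cong_right) (auto simp: F norm_mult power_mult_distrib)
  also have "\<dots> = (\<Sum>(i, \<beta>)\<in>(\<lambda>\<alpha>. (a \<alpha>, b \<alpha>)) ` ?G. (cmod (v $ i))\<^sup>2 * (cmod (ell2_coord \<xi> \<beta>))\<^sup>2)"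
    by (subst sum.reindex) (auto intro: inj_on_subset[OF inj])
  also have "\<dots> \<le> (\<Sum>(i, \<beta>)\<in>UNIV \<times> b ` ?G. (cmod (v $ i))\<^sup>2 * (cmod (ell2_coord \<xi> \<beta>))\<^sup>2)"
    by (rule sum_mono2) (auto simp: F)
  also have "\<dots> = (\<Sum>i\<in>UNIV. (cmod (v $ i))\<^sup>2) * (\<Sum>\<beta>\<in>b ` ?G. (cmod (ell2_coord \<xi> \<beta>))\<^sup>2)"
    by (simp add: sum_product sum.cartesian_product)
  also have "\<dots> = (norm v)\<^sup>2 * (L2_set (\<lambda>\<beta>. cmod (ell2_coord \<xi> \<beta>)) (b ` ?G))\<^sup>2"
    by (simp add: norm_vec_def L2_set_sq)
  also have "\<dots> \<le> (norm v)\<^sup>2 * (norm \<xi>)\<^sup>2"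
    by (intro mult_left_mono power_mono L2_coord_le) (auto simp: F)
  finally show ?thesis
    unfolding L2_set_def by (intro real_le_lsqrt) (auto simp: power_mult_distrib)
qed

lemma inj_hd_tl: "inj_on (\<lambda>\<alpha>. (hd \<alpha>, tl \<alpha>)) (- {[]})"
  by (rule inj_onI) (auto intro: list.expand)

lemma inj_last_butlast: "inj_on (\<lambda>\<alpha>. (last \<alpha>, butlast \<alpha>)) (- {[]})"
proof (rule inj_onI)
  fix \<alpha> \<beta> :: "'a list"
  assume "\<alpha> \<in> - {[]}" "\<beta> \<in> - {[]}" "(last \<alpha>, butlast \<alpha>) = (last \<beta>, butlast \<beta>)"
  then show "\<alpha> = \<beta>"
    by (metis ComplD append_butlast_last_id insertI1 prod.inject)
qed

text \<open>\<open>v \<otimes> \<xi>\<close> and \<open>\<xi> \<otimes> v\<close> for \<open>v\<close> in \<open>H\<^sub>n\<close> and \<open>\<xi>\<close> in the Fock space.\<close>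

lift_definition tensor_left :: "complex ^ 'n::finite \<Rightarrow> 'n fock \<Rightarrow> 'n fock"
  is "\<lambda>v \<xi> \<alpha>. if \<alpha> = [] then 0 else v $ hd \<alpha> * \<xi> (tl \<alpha>)"
  subgoal premises prems for v \<xi>
  proof -
    have eq: "ell2_coord (Abs_ell2 \<xi>) = \<xi>" using prems by (simp add: Abs_ell2_inverse)
    show ?thesis
      using L2_bound(1)[OF word_sum_bound[OF inj_hd_tl, of _ v "Abs_ell2 \<xi>"], unfolded eq] by simp
  qed
  done

lift_definition tensor_right :: "'n::finite fock \<Rightarrow> complex ^ 'n \<Rightarrow> 'n fock"
  is "\<lambda>\<xi> v \<alpha>. if \<alpha> = [] then 0 else v $ last \<alpha> * \<xi> (butlast \<alpha>)"
  subgoal premises prems for \<xi> v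
  proof -
    have eq: "ell2_coord (Abs_ell2 \<xi>) = \<xi>" using prems by (simp add: Abs_ell2_inverse)
    show ?thesis
      using L2_bound(1)[OF word_sum_bound[OF inj_last_butlast, of _ v "Abs_ell2 \<xi>"], unfolded eq] by simp
  qed
  done

lemma bounded_linear_tensor_left: "bounded_linear (tensor_left v)"
proof (rule bounded_linear_intro[where K = "norm v"])
  fix \<xi> \<eta> :: "'a fock" and r
  show "tensor_left v (\<xi> + \<eta>) = tensor_left v \<xi> + tensor_left v \<eta>"
    by transfer (auto simp: algebra_simps)
  show "tensor_left v (r *\<^sub>R \<xi>) = r *\<^sub>R tensor_left v \<xi>"
    by transfer auto
  have "norm (tensor_left v \<xi>) \<le> norm v * norm \<xi>"
    by (rule norm_ell2_le) (use word_sum_bound[OF inj_hd_tl, of _ v \<xi>] in \<open>auto simp: tensor_left.rep_eq\<close>)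
  then show "norm (tensor_left v \<xi>) \<le> norm \<xi> * norm v" by (simp add: mult.commute)
qed

lemma bounded_linear_tensor_right: "bounded_linear (\<lambda>\<xi>. tensor_right \<xi> v)"
proof (rule bounded_linear_intro[where K = "norm v"])
  fix \<xi> \<eta> :: "'a fock" and r
  show "tensor_right (\<xi> + \<eta>) v = tensor_right \<xi> v + tensor_right \<eta> v"
    by transfer (auto simp: algebra_simps)
  show "tensor_right (r *\<^sub>R \<xi>) v = r *\<^sub>R tensor_right \<xi> v"
    by transfer auto
  have "norm (tensor_right \<xi> v) \<le> norm v * norm \<xi>"
    by (rule norm_ell2_le) (use word_sum_bound[OF inj_last_butlast, of _ v \<xi>] in \<open>auto simp: tensor_right.rep_eq\<close>)
  then show "norm (tensor_right \<xi> v) \<le> norm \<xi> * norm v" by (simp add: mult.commute)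
qed

text \<open>The creation operators \<open>S\<^sub>i\<close> and \<open>R\<^sub>i\<close>; \<open>axis i 1\<close> is the basis vector \<open>e\<^sub>i\<close>.\<close>

lift_definition left_creation :: "'n::finite \<Rightarrow> 'n fock \<Rightarrow>\<^sub>L 'n fock"
  is "\<lambda>i \<xi>. tensor_left (axis i 1) \<xi>"
  by (rule bounded_linear_tensor_left)

lift_definition right_creation :: "'n::finite \<Rightarrow> 'n fock \<Rightarrow>\<^sub>L 'n fock"
  is "\<lambda>i \<xi>. tensor_right \<xi> (axis i 1)"
  by (rule bounded_linear_tensor_right)


section \<open>The noncommutative disc algebra\<close>

definition op_subalgebra :: "('a::complex_inner \<Rightarrow>\<^sub>L 'a) set \<Rightarrow> bool" where
  "op_subalgebra B \<longleftrightarrow> 0 \<in> B \<and> (\<forall>X\<in>B. \<forall>Y\<in>B. X + Y \<in> B \<and> X o\<^sub>L Y \<in> B) \<and> (\<forall>c. \<forall>X\<in>B. c *\<^sub>C X \<in> B)"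

definition disc_algebra :: "('n::finite fock \<Rightarrow>\<^sub>L 'n fock) set" where
  "disc_algebra = \<Inter>{B. op_subalgebra B \<and> closed B \<and> id_blinfun \<in> B \<and> range left_creation \<subseteq> B}"

text \<open>The norm of a \<open>k \<times> k\<close> matrix of operators, acting on the direct sum of \<open>k\<close> copies of the space.\<close>

definition op_matrix_norm :: "nat \<Rightarrow> (nat \<Rightarrow> nat \<Rightarrow> 'a::real_normed_vector \<Rightarrow>\<^sub>L 'a) \<Rightarrow> real" where
  "op_matrix_norm k X =
    Sup {L2_set (\<lambda>p. norm (\<Sum>q<k. blinfun_apply (X p q) (x q))) {..<k} | x.
      L2_set (\<lambda>q. norm (x q)) {..<k} \<le> 1}"

definition completely_isometric_on ::
  "('a::complex_inner \<Rightarrow>\<^sub>L 'a) set \<Rightarrow> (('a \<Rightarrow>\<^sub>L 'a) \<Rightarrow> ('a \<Rightarrow>\<^sub>L 'a)) \<Rightarrow> bool" where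
  "completely_isometric_on B \<phi> \<longleftrightarrow>
    (\<forall>k X. (\<forall>p<k. \<forall>q<k. X p q \<in> B) \<longrightarrow> op_matrix_norm k (\<lambda>p q. \<phi> (X p q)) = op_matrix_norm k X)"

definition algebra_automorphism ::
  "('a::complex_inner \<Rightarrow>\<^sub>L 'a) set \<Rightarrow> (('a \<Rightarrow>\<^sub>L 'a) \<Rightarrow> ('a \<Rightarrow>\<^sub>L 'a)) \<Rightarrow> bool" where
  "algebra_automorphism B \<phi> \<longleftrightarrow> bij_betw \<phi> B B \<and> \<phi> id_blinfun = id_blinfun \<and>
    (\<forall>X\<in>B. \<forall>Y\<in>B. \<phi> (X + Y) = \<phi> X + \<phi> Y \<and> \<phi> (X o\<^sub>L Y) = \<phi> X o\<^sub>L \<phi> Y) \<and>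
    (\<forall>c. \<forall>X\<in>B. \<phi> (c *\<^sub>C X) = c *\<^sub>C \<phi> X)"

definition unitaries :: "(complex ^ 'n ^ 'n::finite) set" where
  "unitaries = {U. U ** (\<chi> i j. cnj (U $ j $ i)) = mat 1 \<and> (\<chi> i j. cnj (U $ j $ i)) ** U = mat 1}"

definition gauge_tuple ::
  "complex ^ 'n ^ 'n::finite \<Rightarrow> ('n \<Rightarrow> 'h::complex_inner \<Rightarrow>\<^sub>L 'h) \<Rightarrow> 'n \<Rightarrow> 'h \<Rightarrow>\<^sub>L 'h" where
  "gauge_tuple U T = (\<lambda>j. \<Sum>i\<in>UNIV. U $ i $ j *\<^sub>C T i)"

text \<open>An automorphism is only determined on \<^const>\<open>disc_algebra\<close>; \<^const>\<open>extensional\<close>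
  fixes a dummy value elsewhere, so that it is unique as a HOL function.\<close>

definition gauge_automorphism ::
  "complex ^ 'n ^ 'n::finite \<Rightarrow> ('n fock \<Rightarrow>\<^sub>L 'n fock) \<Rightarrow> ('n fock \<Rightarrow>\<^sub>L 'n fock)" where
  "gauge_automorphism U = (THE \<phi>. \<phi> \<in> extensional disc_algebra \<and>
    algebra_automorphism disc_algebra \<phi> \<and> completely_isometric_on disc_algebra \<phi> \<and>
    (\<forall>j. \<phi> (left_creation j) = (\<Sum>i\<in>UNIV. U $ i $ j *\<^sub>C left_creation i)))"


section \<open>Cauchy kernel and Cauchy transform\<close>

text \<open>The Hilbert space tensor product of \<^typ>\<open>('i, complex) ell2\<close> and \<open>'h\<close> is
  \<^typ>\<open>('i, 'h) ell2\<close>, with the elementary tensors below: by \<open>cinner_tensor\<close> and \<open>tensor_total\<close>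
  they have the right inner products and a dense linear span.\<close>

lift_definition tensor :: "('i, complex) ell2 \<Rightarrow> 'h::complex_inner \<Rightarrow> ('i, 'h) ell2"
  is "\<lambda>\<xi> x i. \<xi> i *\<^sub>C x"
  by (auto simp: norm_scaleC power_mult_distrib intro: summable_on_cmult_left)

lemma cinner_tensor: "cinner (tensor \<xi> x) (tensor \<eta> y) = cinner \<xi> \<eta> * cinner x y"
proof transfer
  fix \<xi> \<eta> :: "'a \<Rightarrow> complex" and x y :: 'b
  have "cinner (\<xi> i *\<^sub>C x) (\<eta> i *\<^sub>C y) = cinner (\<xi> i) (\<eta> i) * cinner x y" for i
    by (simp add: cinner_scaleC_left cinner_scaleC_right cinner_complex_def)
  then show "(\<Sum>\<^sub>\<infinity>i. cinner (\<xi> i *\<^sub>C x) (\<eta> i *\<^sub>C y)) = (\<Sum>\<^sub>\<infinity>i. cinner (\<xi> i) (\<eta> i)) * cinner x y"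
    by (simp add: infsum_cmult_left')
qed

lemma tensor_total: "closure (span (range (case_prod tensor))) = (UNIV :: ('i, 'h::complex_inner) ell2 set)"
proof -
  have "f \<in> closure (span (range (case_prod tensor)))" for f :: "('i, 'h) ell2"
    unfolding closure_approachable
  proof (intro allI impI)
    fix e :: real assume e: "e > 0"
    let ?n = "\<lambda>i. (norm (ell2_coord f i))\<^sup>2"
    have summ: "?n summable_on UNIV" using ell2_coord[of f] by simp
    then have "(sum ?n \<longlongrightarrow> infsum ?n UNIV) (finite_subsets_at_top UNIV)"
      using has_sum_infsum has_sum_def by blast
    then have "\<forall>\<^sub>F F in finite_subsets_at_top UNIV. dist (sum ?n F) (infsum ?n UNIV) < e\<^sup>2"
      using e by (auto dest!: tendstoD[where e = "e\<^sup>2"])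
    then obtain F where F: "finite F" "dist (sum ?n F) (infsum ?n UNIV) < e\<^sup>2"
      by (metis (no_types, lifting) eventually_finite_subsets_at_top order.refl subset_UNIV)
    define b :: "'i \<Rightarrow> ('i, complex) ell2" where "b i = Abs_ell2 (\<lambda>j. if j = i then 1 else 0)" for i
    have "(\<lambda>j. (cmod (if j = i then 1 else 0))\<^sup>2) summable_on UNIV" for i :: 'i
      using summable_on_cong_neutral[of "{i}" UNIV "\<lambda>j. (cmod (if j = i then 1 else 0))\<^sup>2"
          "\<lambda>j. (cmod (if j = i then 1 else 0))\<^sup>2"] by auto
    then have b: "ell2_coord (b i) = (\<lambda>j. if j = i then 1 else 0)" for i
      unfolding b_def by (subst Abs_ell2_inverse) auto
    define g where "g = (\<Sum>i\<in>F. tensor (b i) (ell2_coord f i))"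
    have coord_sum: "ell2_coord (\<Sum>i\<in>F. h i) j = (\<Sum>i\<in>F. ell2_coord (h i) j)"
      for h :: "'i \<Rightarrow> ('i, 'h) ell2" and j
      using F(1) by (induction F) (auto simp: zero_ell2.rep_eq plus_ell2.rep_eq)
    have g: "ell2_coord g j = (if j \<in> F then ell2_coord f j else 0)" for j
    proof -
      have "ell2_coord g j = (\<Sum>i\<in>F. if i = j then ell2_coord f i else 0)"
        unfolding g_def coord_sum by (rule sum.cong) (auto simp: tensor.rep_eq b)
      then show ?thesis using F(1) by simp
    qed
    have "(norm (g - f))\<^sup>2 = (\<Sum>\<^sub>\<infinity>i\<in>UNIV - F. ?n i)"
      unfolding norm_ell2_sq
      by (rule infsum_cong_neutral) (auto simp: g minus_ell2.rep_eq)
    also have "\<dots> = infsum ?n UNIV - infsum ?n F"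
      by (rule infsum_Diff) (use summ F(1) in auto)
    also have "\<dots> < e\<^sup>2"
      using F by (simp add: dist_real_def)
    finally have "dist g f < e"
      using e by (simp add: dist_norm power2_less_imp_less)
    moreover have "g \<in> span (range (case_prod tensor))"
      unfolding g_def by (intro span_sum span_base) auto
    ultimately show "\<exists>y\<in>span (range (case_prod tensor)). dist y f < e" by blast
  qed
  then show ?thesis by auto
qed

definition op_tensor ::
  "('i, complex) ell2 \<Rightarrow>\<^sub>L ('i, complex) ell2 \<Rightarrow> 'h::complex_inner \<Rightarrow>\<^sub>L 'h \<Rightarrow> ('i, 'h) ell2 \<Rightarrow>\<^sub>L ('i, 'h) ell2" where
  "op_tensor A B = (THE C. C \<in> bounded_ops \<and>
    (\<forall>\<xi> x. blinfun_apply C (tensor \<xi> x) = tensor (blinfun_apply A \<xi>) (blinfun_apply B x)))"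

definition cauchy_kernel ::
  "('n::finite \<Rightarrow> 'h::chilbert_space \<Rightarrow>\<^sub>L 'h) \<Rightarrow> ('n list, 'h) ell2 \<Rightarrow>\<^sub>L ('n list, 'h) ell2" where
  "cauchy_kernel T =
    (\<Sum>k. \<Sum>\<alpha> | length \<alpha> = k. op_tensor (op_word right_creation \<alpha>) (adj (op_word T (rev \<alpha>))))"

definition cauchy_transform ::
  "('n::finite \<Rightarrow> 'h::chilbert_space \<Rightarrow>\<^sub>L 'h) \<Rightarrow> 'n fock \<Rightarrow>\<^sub>L 'n fock \<Rightarrow> 'h \<Rightarrow>\<^sub>L 'h" where
  "cauchy_transform T A = (THE C. C \<in> bounded_ops \<and>
    (\<forall>x y. cinner (blinfun_apply C x) y =
      cinner (blinfun_apply (op_tensor A id_blinfun) (tensor vacuum x))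
             (blinfun_apply (cauchy_kernel T) (tensor vacuum y))))"

end

theory Submission
  imports Defs
begin

text \<open>
  The second quantization \<open>\<Gamma>\<close> of \<open>U\<close> acts on \<open>F\<^sup>2(H\<^sub>n) \<otimes> H\<close>, is unitary, fixes the vacuum and satisfies
  \<open>\<Gamma> S\<^sub>j = (\<Sum>\<^sub>i \<lambda>\<^sub>i\<^sub>j S\<^sub>i) \<Gamma>\<close>; hence \<open>\<beta>\<^sub>U\<close> is conjugation by \<open>\<Gamma>\<close>. On vectors \<open>1 \<otimes> y\<close> the
  Cauchy kernel of \<open>T\<close> has the coefficient \<open>T\<^sub>\<alpha>\<^sup>* y\<close> at the word \<open>\<alpha>\<close>, so that the adjoint of \<open>\<Gamma>\<close> maps
  it to the Cauchy kernel of \<open>\<beta>\<^sub>U(T)\<close>. Moving \<open>\<Gamma>\<close> to the other side of the inner product turns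
  the form that defines the left-hand side into the one that defines the right-hand side.
  Convergence of the kernels: the \<open>R\<^sub>\<alpha>\<close> with \<open>|\<alpha>| = k\<close> are isometries with orthogonal ranges, so that the
  square of the norm of the degree \<open>k\<close> part is at most \<open>a\<^sub>k\<close>, the norm of the sum of all \<open>T\<^sub>\<alpha> T\<^sub>\<alpha>\<^sup>*\<close> with
  \<open>|\<alpha>| = k\<close>. The sequence \<open>a\<close> is submultiplicative, so the limit defining the joint spectral radius
  exists by Fekete's lemma, and the root test applies.
\<close>

section \<open>Adjoints\<close>

instance chilbert_space \<subseteq> banach ..

lemma scaleC_sum_right: "c *\<^sub>C (\<Sum>i\<in>I. f i) = (\<Sum>i\<in>I. c *\<^sub>C (f i :: 'a::complex_inner))"
  by (induction I rule: infinite_finite_induct) (auto simp: scaleC_add_right)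

lemma scaleC_sum_left: "(\<Sum>i\<in>I. f i) *\<^sub>C x = (\<Sum>i\<in>I. f i *\<^sub>C (x :: 'a::complex_inner))"
  by (induction I rule: infinite_finite_induct) (auto simp: scaleC_add_left)

lemma scaleC_minus_left: "(- c) *\<^sub>C (x :: 'a::complex_inner) = - (c *\<^sub>C x)"
  by (metis add.right_inverse eq_neg_iff_add_eq_0 neg_eq_iff_add_eq_0 scaleC_add_left scaleC_zero_left)

lemma cinner_sum_left: "cinner (\<Sum>i\<in>I. f i) y = (\<Sum>i\<in>I. cinner (f i) (y :: 'a::complex_inner))"
  by (induction I rule: infinite_finite_induct) (auto simp: cinner_add_left)

lemma cinner_sum_right: "cinner y (\<Sum>i\<in>I. f i) = (\<Sum>i\<in>I. cinner (y :: 'a::complex_inner) (f i))"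
  by (induction I rule: infinite_finite_induct) (auto simp: cinner_add_right)

lemma cinner_minus_left: "cinner (- x) y = - cinner (x :: 'a::complex_inner) y"
  by (metis add.right_inverse cinner_add_left cinner_zero_left eq_neg_iff_add_eq_0 add.commute)

lemma cinner_diff_left: "cinner (x - z) y = cinner (x :: 'a::complex_inner) y - cinner z y"
  using cinner_add_left[of x "-z" y] by (simp add: cinner_minus_left)

lemma cinner_diff_right: "cinner y (x - z) = cinner (y :: 'a::complex_inner) x - cinner y z"
  by (metis cinner_commute cinner_diff_left complex_cnj_diff)

text \<open>Source of the parallelogram law, of Pythagoras and of the polarization argument
  below.\<close>

lemma norm_add_sq:
  "(norm (x + y :: 'a::complex_inner))\<^sup>2 = (norm x)\<^sup>2 + (norm y)\<^sup>2 + 2 * Re (cinner x y)"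
proof -
  have "complex_of_real ((norm (x + y))\<^sup>2)
      = complex_of_real ((norm x)\<^sup>2) + complex_of_real ((norm y)\<^sup>2) + (cinner x y + cnj (cinner x y))"
    unfolding cinner_self[symmetric]
    by (simp add: cinner_add_left cinner_add_right cinner_commute[of y x])
  also have "\<dots> = complex_of_real ((norm x)\<^sup>2 + (norm y)\<^sup>2 + 2 * Re (cinner x y))"
    by (simp add: complex_add_cnj)
  finally show ?thesis
    using of_real_eq_iff by blast
qed

lemma cinner_ext:
  assumes "\<And>x. cinner x y = cinner x (z :: 'a::complex_inner)"
  shows "y = z"
proof -
  have "complex_of_real ((norm (y - z))\<^sup>2) = 0"
    by (simp only: cinner_self[symmetric] cinner_diff_right assms) simp
  then show ?thesis by simp
qed

section \<open>Riesz representation and adjoints\<close>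

text \<open>For a representing vector v, \<open>q x\<close> would be |x - v|^2 - |v|^2, so v is
  sought as the minimizer of \<open>q\<close>. Completeness enters through the limit of a minimizing
  sequence.\<close>

lemma riesz_representation:
  fixes f :: "'a::chilbert_space \<Rightarrow> complex"
  assumes lin: "bounded_linear f" and sc: "\<And>c x. f (c *\<^sub>C x) = c * f x"
  obtains v where "\<And>x. f x = cinner x v"
proof -
  interpret f: bounded_linear f by (rule lin)
  obtain K where K: "\<And>x. norm (f x) \<le> norm x * K" "K > 0" using f.pos_bounded by blast
  define q where "q x = (norm x)\<^sup>2 - 2 * Re (f x)" for x
  \<comment> \<open>Completing the square gives \<open>q x\<close> \<ge> (norm x - K)^2 -
    K^2.\<close>
  have lower: "- K\<^sup>2 \<le> q x" for x
  proof -
    have "Re (f x) \<le> norm x * K" using K(1)[of x] complex_Re_le_cmod[of "f x"] by linarith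
    moreover have "0 \<le> (norm x - K)\<^sup>2" by simp
    ultimately show ?thesis by (simp add: q_def power2_diff)
  qed
  define m where "m = Inf (range q)"
  have bdd: "bdd_below (range q)" using lower by (auto intro!: bdd_belowI[where m = "- K\<^sup>2"])
  have m_le: "m \<le> q x" for x unfolding m_def by (rule cInf_lower[OF _ bdd]) simp
  have "\<exists>x. q x < m + 1 / real (Suc n)" for n
    using cInf_lessD[of "range q" "m + 1 / real (Suc n)"] by (auto simp: m_def)
  then obtain X where X: "\<And>n. q (X n) < m + 1 / real (Suc n)" by metis
  \<comment> \<open>The parallelogram law, in which the linear part of \<open>q\<close> cancels. Two
    near-minimizers are close because \<open>q\<close> at their midpoint cannot fall below
    \<open>m\<close>.\<close>
  have par: "(norm (x - y))\<^sup>2 = 2 * q x + 2 * q y - 4 * q ((1/2) *\<^sub>R (x + y))" for x y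
  proof -
    have "(norm (x + y))\<^sup>2 + (norm (x + - y))\<^sup>2 = 2 * (norm x)\<^sup>2 + 2 * (norm y)\<^sup>2"
      unfolding norm_add_sq by (simp add: cinner_diff_right[of x 0 y, simplified])
    then show ?thesis
      unfolding q_def f.scaleR f.add norm_scaleR power_mult_distrib
      by (simp add: power2_eq_square field_simps)
  qed
  have close: "(norm (X i - X j))\<^sup>2 \<le> 2 / real (Suc i) + 2 / real (Suc j)" for i j
    using X[of i] X[of j] m_le[of "(1/2) *\<^sub>R (X i + X j)"] unfolding par by simp
  have "Cauchy X"
  proof (rule metric_CauchyI)
    fix e :: real assume e: "e > 0"
    obtain N where N: "4 / e\<^sup>2 < real N" using reals_Archimedean2 by blast
    have "dist (X i) (X j) < e" if "i \<ge> N" "j \<ge> N" for i j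
    proof -
      have Np: "real N > 0" using N e by (smt (verit) divide_nonneg_nonneg zero_le_power2)
      have "2 / real (Suc i) \<le> 2 / real (Suc N)" "2 / real (Suc j) \<le> 2 / real (Suc N)"
        using that by (auto intro!: divide_left_mono)
      then have "(norm (X i - X j))\<^sup>2 \<le> 4 / real (Suc N)" using close[of i j] by simp
      also have "\<dots> < 4 / real N" using Np by (simp add: field_simps)
      also have "\<dots> < e\<^sup>2" using N e Np by (simp add: field_simps)
      finally show ?thesis using e by (simp add: dist_norm power2_less_imp_less)
    qed
    then show "\<exists>M. \<forall>i\<ge>M. \<forall>j\<ge>M. dist (X i) (X j) < e" by blast
  qed
  then obtain v where v: "X \<longlonglongrightarrow> v" using Cauchy_convergent convergent_def by blast
  have "(\<lambda>n. q (X n)) \<longlonglongrightarrow> q v"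
    unfolding q_def by (intro tendsto_intros v f.tendsto)
  moreover have "(\<lambda>n. m + 1 / real (Suc n)) \<longlonglongrightarrow> m + 0"
    by (intro tendsto_intros LIMSEQ_Suc[OF lim_1_over_n])
  ultimately have qv: "q v \<le> m"
    using LIMSEQ_le[of "\<lambda>n. q (X n)" "q v" "\<lambda>n. m + 1 / real (Suc n)" "m + 0"] X
    by (auto intro: less_imp_le)
  have re: "Re (f x) = Re (cinner x v)" for x
  proof -
    define d where "d = Re (cinner x v) - Re (f x)"
    \<comment> \<open>First-order condition: the right-hand side is
      \<open>q (t *\<^sub>R x + v) - q v\<close>.\<close>
    have *: "0 \<le> t\<^sup>2 * (norm x)\<^sup>2 + 2 * t * d" for t
    proof -
      have "q v \<le> q (t *\<^sub>R x + v)" using qv m_le[of "t *\<^sub>R x + v"] by linarith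
      then show ?thesis
        unfolding q_def norm_add_sq d_def scaleC_of_real[symmetric]
        by (simp add: norm_scaleC cinner_scaleC_left f.add sc power_mult_distrib algebra_simps)
    qed
    have "d = 0"
    proof (rule ccontr)
      assume d: "d \<noteq> 0"
      \<comment> \<open>With \<open>t = - d / s\<close> the linear term outweighs the quadratic one;
        the summand 1 keeps \<open>s\<close> positive when \<open>x = 0\<close>.\<close>
      define s where "s = (norm x)\<^sup>2 + 1"
      have s: "s > 0" "(norm x)\<^sup>2 < s" by (simp_all add: s_def add_nonneg_pos)
      have "(- d / s)\<^sup>2 * (norm x)\<^sup>2 + 2 * (- d / s) * d = (d / s)\<^sup>2 * ((norm x)\<^sup>2 - 2 * s)"
        using s by (simp add: power2_eq_square field_simps)
      also have "\<dots> < 0" using s d by (intro mult_pos_neg) auto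
      finally show False using *[of "- d / s"] by linarith
    qed
    then show ?thesis by (simp add: d_def)
  qed
  \<comment> \<open>Imaginary parts follow by passing to \<open>\<i> *\<^sub>C x\<close>.\<close>
  have "f x = cinner x v" for x
    using re[of x] re[of "\<i> *\<^sub>C x"] by (simp add: complex_eq_iff sc cinner_scaleC_left)
  then show ?thesis by (rule that)
qed

lemma bounded_linear_cinner_left: "bounded_linear (\<lambda>x. cinner x (y :: 'a::complex_inner))"
  by (rule bounded_linear_intro[where K = "norm y"])
    (auto simp: cinner_add_left scaleC_of_real[symmetric] cinner_scaleC_left scaleC_complex_def cauchy_schwarz)

text \<open>Inner products separate vectors, so the definite description behind \<open>adj\<close>
  has at most one solution and any candidate computes it.\<close>

lemma adj_eqI:
  fixes A :: "'a::complex_inner \<Rightarrow>\<^sub>L 'b::complex_inner" and B :: "'b \<Rightarrow>\<^sub>L 'a"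
  assumes "\<And>x y. cinner (A x) y = cinner x (B y)"
  shows "adj A = B"
  unfolding adj_def
proof (rule the_equality)
  show "\<forall>x y. cinner (A x) y = cinner x (B y)" using assms by blast
  fix C :: "'b \<Rightarrow>\<^sub>L 'a" assume C: "\<forall>x y. cinner (A x) y = cinner x (C y)"
  show "C = B"
    by (rule blinfun_eqI, rule cinner_ext) (metis C assms)
qed

text \<open>The Riesz vectors of the functionals \<open>\<lambda>x. cinner (A x) y\<close> depend
  additively and boundedly on \<open>y\<close>. Membership in \<open>bounded_ops\<close> supplies
  the complex homogeneity that Riesz asks for.\<close>

lemma adj_exists:
  fixes A :: "'a::chilbert_space \<Rightarrow>\<^sub>L 'b::complex_inner"
  assumes A: "A \<in> bounded_ops"
  shows "cinner (A x) y = cinner x (adj A y)"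
proof -
  have "\<exists>v. \<forall>x. cinner (A x) y = cinner x v" for y
  proof -
    have "bounded_linear (\<lambda>x. cinner (A x) y)"
      by (rule bounded_linear_compose[OF bounded_linear_cinner_left blinfun.bounded_linear_right])
    then show ?thesis
      using A by (elim riesz_representation) (auto simp: bounded_ops_def cinner_scaleC_left)
  qed
  then obtain B where B: "\<And>x y. cinner (A x) y = cinner x (B y)" by metis
  have "bounded_linear B"
  proof (rule bounded_linear_intro[where K = "norm A"])
    fix y z r
    show "B (y + z) = B y + B z"
      by (rule cinner_ext) (simp add: B[symmetric] cinner_add_right)
    show "B (r *\<^sub>R y) = r *\<^sub>R B y"
      by (rule cinner_ext) (simp add: B[symmetric] cinner_scaleC_right scaleC_of_real[symmetric])
    \<comment> \<open>Testing against \<open>x = B y\<close>, after which one factor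
      \<open>norm (B y)\<close> cancels.\<close>
    have "complex_of_real ((norm (B y))\<^sup>2) = cinner (A (B y)) y" by (simp add: B cinner_self)
    then have "(norm (B y))\<^sup>2 = cmod (cinner (A (B y)) y)"
      by (metis norm_of_real abs_of_nonneg zero_le_power2)
    also have "\<dots> \<le> norm (A (B y)) * norm y" by (rule cauchy_schwarz)
    also have "\<dots> \<le> norm A * norm (B y) * norm y" by (intro mult_right_mono norm_blinfun) simp
    finally have "norm (B y) * norm (B y) \<le> norm (B y) * (norm y * norm A)"
      by (simp add: power2_eq_square mult_ac)
    then show "norm (B y) \<le> norm y * norm A"
      by (cases "B y = 0") (auto simp: zero_le_mult_iff)
  qed
  then have "blinfun_apply (Blinfun B) = B" by (rule bounded_linear_Blinfun_apply)
  then show ?thesis using adj_eqI[of A "Blinfun B"] B by simp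
qed

lemma adj_id: "adj (id_blinfun :: 'a::complex_inner \<Rightarrow>\<^sub>L 'a) = id_blinfun"
  by (rule adj_eqI) simp

lemma adj_compose:
  fixes A :: "'b::chilbert_space \<Rightarrow>\<^sub>L 'c::complex_inner" and B :: "'a::chilbert_space \<Rightarrow>\<^sub>L 'b"
  assumes "A \<in> bounded_ops" "B \<in> bounded_ops"
  shows "adj (A o\<^sub>L B) = adj B o\<^sub>L adj A"
  by (rule adj_eqI) (simp add: adj_exists assms)

lemma adj_bounded_ops:
  fixes A :: "'a::chilbert_space \<Rightarrow>\<^sub>L 'b::complex_inner"
  assumes "A \<in> bounded_ops"
  shows "adj A \<in> bounded_ops"
proof -
  have "adj A (c *\<^sub>C y) = c *\<^sub>C adj A y" for c y
    by (rule cinner_ext) (simp add: adj_exists[OF assms, symmetric] cinner_scaleC_right)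
  then show ?thesis by (simp add: bounded_ops_def)
qed

lemma op_word_bounded_ops:
  assumes "\<And>i. T i \<in> bounded_ops"
  shows "op_word T \<alpha> \<in> bounded_ops"
  using assms by (induction \<alpha>) (auto simp: bounded_ops_def)

section \<open>Second quantization of a unitary\<close>

lemma words_Suc: "{\<alpha> :: 'n list. length \<alpha> = Suc k} = (\<lambda>(i, \<alpha>). i # \<alpha>) ` (UNIV \<times> {\<alpha>. length \<alpha> = k})"
  by (auto simp: length_Suc_conv)

lemma finite_words [simp]: "finite {\<alpha> :: 'n::finite list. length \<alpha> = k}"
  using finite_lists_length_eq[of "UNIV :: 'n set" k] by simp

lemma sum_words_Suc:
  "(\<Sum>\<alpha> | length (\<alpha> :: 'n::finite list) = Suc k. g \<alpha>) = (\<Sum>i\<in>UNIV. \<Sum>\<alpha> | length \<alpha> = k. g (i # \<alpha>))"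
  unfolding words_Suc by (subst sum.reindex) (auto simp: inj_on_def sum.cartesian_product intro!: sum.cong)

definition ctrans :: "complex ^ 'n ^ 'n \<Rightarrow> complex ^ 'n ^ 'n" where
  "ctrans U = (\<chi> i j. cnj (U $ j $ i))"

lemma ctrans_nth [simp]: "ctrans U $ i $ j = cnj (U $ j $ i)"
  by (simp add: ctrans_def)

lemma ctrans_ctrans [simp]: "ctrans (ctrans U) = U"
  by (simp add: vec_eq_iff)

lemma unitaries_iff: "U \<in> unitaries \<longleftrightarrow> U ** ctrans U = mat 1 \<and> ctrans U ** U = mat 1"
  by (simp add: unitaries_def ctrans_def)

lemma ctrans_unitaries: "U \<in> unitaries \<Longrightarrow> ctrans U \<in> unitaries"
  by (simp add: unitaries_iff)

text \<open>Expanding the squares gives a triple sum; summing over the row index first leaves the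
  orthonormality of the columns of \<open>U\<close>.\<close>

lemma unitary_sum_norm_sq:
  fixes v :: "'n::finite \<Rightarrow> 'h::complex_inner"
  assumes "U \<in> unitaries"
  shows "(\<Sum>i\<in>UNIV. (norm (\<Sum>j\<in>UNIV. U $ i $ j *\<^sub>C v j))\<^sup>2) = (\<Sum>j\<in>UNIV. (norm (v j))\<^sup>2)"
proof -
  have U: "(\<Sum>i\<in>UNIV. cnj (U $ i $ l) * U $ i $ j) = (if l = j then 1 else 0)" for j l
  proof -
    have "(ctrans U ** U) $ l $ j = mat 1 $ l $ j" using assms by (simp add: unitaries_iff)
    then show ?thesis by (simp add: matrix_matrix_mult_def mat_def)
  qed
  have "complex_of_real (\<Sum>i\<in>UNIV. (norm (\<Sum>j\<in>UNIV. U $ i $ j *\<^sub>C v j))\<^sup>2)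
      = (\<Sum>i\<in>UNIV. \<Sum>j\<in>UNIV. \<Sum>l\<in>UNIV. cnj (U $ i $ l) * U $ i $ j * cinner (v j) (v l))"
    unfolding of_real_sum cinner_self[symmetric]
    by (simp add: cinner_sum_left cinner_sum_right cinner_scaleC_left cinner_scaleC_right
        sum_distrib_left mult_ac) (rule sum.cong[OF refl], rule sum.swap)
  also have "\<dots> = (\<Sum>j\<in>UNIV. \<Sum>l\<in>UNIV. \<Sum>i\<in>UNIV. cnj (U $ i $ l) * U $ i $ j * cinner (v j) (v l))"
    by (subst sum.swap) (intro sum.cong refl sum.swap)
  also have "\<dots> = (\<Sum>j\<in>UNIV. \<Sum>l\<in>UNIV. if l = j then cinner (v j) (v l) else 0)"
    unfolding sum_distrib_right[symmetric] U by (intro sum.cong refl) auto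
  also have "\<dots> = complex_of_real (\<Sum>j\<in>UNIV. (norm (v j))\<^sup>2)"
    by (simp add: cinner_self)
  finally show ?thesis using of_real_eq_iff by blast
qed

section \<open>Tensor powers of a matrix\<close>

text \<open>On coefficient families of degree \<open>k\<close> this is the \<open>k\<close>-fold tensor power of \<open>U\<close>.\<close>

fun word_map :: "complex ^ 'n ^ 'n \<Rightarrow> ('n list \<Rightarrow> 'h::complex_inner) \<Rightarrow> 'n::finite list \<Rightarrow> 'h" where
  "word_map U f [] = f []"
| "word_map U f (i # \<alpha>) = (\<Sum>j\<in>UNIV. U $ i $ j *\<^sub>C word_map U (\<lambda>\<beta>. f (j # \<beta>)) \<alpha>)"

text \<open>The values of \<open>word_map U f\<close> are finite linear combinations of values of
  \<open>f\<close>, hence compatible with complex-linear maps.\<close>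

lemma word_map_comp:
  assumes "\<And>x y. L (x + y) = L x + L y" "\<And>c x. L (c *\<^sub>C x) = c *\<^sub>C L x"
  shows "word_map U (\<lambda>\<beta>. L (f \<beta>)) \<alpha> = L (word_map U f \<alpha>)"
proof -
  have "L 0 = 0" using assms(2)[of 0 0] by simp
  then have sum: "L (\<Sum>i\<in>I. g i) = (\<Sum>i\<in>I. L (g i))" for I :: "'i set" and g
    by (induction I rule: infinite_finite_induct) (auto simp: assms(1))
  show ?thesis
    by (induction \<alpha> arbitrary: f) (simp_all add: sum assms(2))
qed

lemma word_map_add: "word_map U (\<lambda>\<beta>. f \<beta> + g \<beta>) \<alpha> = word_map U f \<alpha> + word_map U g \<alpha>"
  by (induction \<alpha> arbitrary: f g) (simp_all add: scaleC_add_right sum.distrib)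

lemma word_map_scaleC: "word_map U (\<lambda>\<beta>. c *\<^sub>C f \<beta>) \<alpha> = c *\<^sub>C word_map U f \<alpha>"
  by (rule word_map_comp) (simp_all add: scaleC_add_right scaleC_scaleC mult.commute)

lemma word_map_zero: "word_map U (\<lambda>\<beta>. 0) \<alpha> = 0"
  using word_map_scaleC[of U 0] by simp

lemma word_map_sum: "word_map U (\<lambda>\<beta>. \<Sum>i\<in>I. f i \<beta>) \<alpha> = (\<Sum>i\<in>I. word_map U (f i) \<alpha>)"
  by (induction I rule: infinite_finite_induct) (simp_all add: word_map_zero word_map_add)

text \<open>Tensor powers are functorial. In the inductive step linearity moves the coefficients of
  \<open>V\<close> out, and the sum over the middle index is a matrix product.\<close>

lemma word_map_mult: "word_map U (word_map V f) \<alpha> = word_map (U ** V) f \<alpha>"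
proof (induction \<alpha> arbitrary: f)
  case (Cons i \<alpha>)
  have "word_map U (word_map V f) (i # \<alpha>)
      = (\<Sum>j\<in>UNIV. \<Sum>l\<in>UNIV. (U $ i $ j * V $ j $ l) *\<^sub>C word_map (U ** V) (\<lambda>\<beta>. f (l # \<beta>)) \<alpha>)"
    by (simp add: word_map_sum word_map_scaleC Cons scaleC_sum_right scaleC_scaleC)
  also have "\<dots> = word_map (U ** V) f (i # \<alpha>)"
    by (subst sum.swap) (simp add: matrix_matrix_mult_def scaleC_sum_left)
  finally show ?case .
qed simp

lemma word_map_one: "word_map (mat 1) f \<alpha> = f \<alpha>"
proof (induction \<alpha> arbitrary: f)
  case (Cons i \<alpha>)
  have "word_map (mat 1) f (i # \<alpha>) = (\<Sum>j\<in>UNIV. if i = j then f (j # \<alpha>) else 0)"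
    unfolding word_map.simps Cons by (rule sum.cong) (auto simp: mat_def)
  then show ?case by simp
qed simp

text \<open>The first letter is handled by \<open>unitary_sum_norm_sq\<close> for each fixed
  remainder, the remaining letters by induction.\<close>

lemma word_map_norm_sq:
  assumes U: "U \<in> unitaries"
  shows "(\<Sum>\<alpha> | length \<alpha> = k. (norm (word_map U f \<alpha>))\<^sup>2) = (\<Sum>\<alpha> | length \<alpha> = k. (norm (f \<alpha>))\<^sup>2)"
proof (induction k arbitrary: f)
  case (Suc k)
  have "(\<Sum>\<alpha> | length \<alpha> = Suc k. (norm (word_map U f \<alpha>))\<^sup>2)
      = (\<Sum>\<alpha> | length \<alpha> = k. \<Sum>i\<in>UNIV. (norm (\<Sum>j\<in>UNIV. U $ i $ j *\<^sub>C word_map U (\<lambda>\<beta>. f (j # \<beta>)) \<alpha>))\<^sup>2)"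
    unfolding sum_words_Suc by (subst sum.swap) simp
  also have "\<dots> = (\<Sum>j\<in>UNIV. \<Sum>\<alpha> | length \<alpha> = k. (norm (word_map U (\<lambda>\<beta>. f (j # \<beta>)) \<alpha>))\<^sup>2)"
    unfolding unitary_sum_norm_sq[OF U] by (rule sum.swap)
  also have "\<dots> = (\<Sum>\<alpha> | length \<alpha> = Suc k. (norm (f \<alpha>))\<^sup>2)"
    unfolding sum_words_Suc by (intro sum.cong refl Suc.IH)
  finally show ?case .
qed simp

text \<open>A finite set of words meets only finitely many degrees. Enlarged to all words of length
  at most \<open>N\<close>, it allows the isometry in each single degree to be applied.\<close>

lemma word_map_L2_le:
  fixes f :: "('n::finite list, 'h::complex_inner) ell2"
  assumes U: "U \<in> unitaries" and F: "finite F"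
  shows "L2_set (\<lambda>\<alpha>. norm (word_map U (ell2_coord f) \<alpha>)) F \<le> norm f"
proof -
  let ?W = "\<lambda>k. {\<alpha> :: 'n list. length \<alpha> = k}"
  \<comment> \<open>Inserting 0 keeps \<open>Max\<close> meaningful for empty
    \<open>F\<close>.\<close>
  define N where "N = Max (insert 0 (length ` F))"
  have split: "(\<Sum>\<alpha>\<in>(\<Union>k\<le>N. ?W k). g \<alpha>) = (\<Sum>k\<le>N. \<Sum>\<alpha>\<in>?W k. g \<alpha>)" for g :: "'n list \<Rightarrow> real"
    by (rule sum.UNION_disjoint) auto
  have fin: "finite (\<Union>k\<le>N. ?W k)" by simp
  have "F \<subseteq> (\<Union>k\<le>N. ?W k)" using F by (auto simp: N_def)
  then have "L2_set (\<lambda>\<alpha>. norm (word_map U (ell2_coord f) \<alpha>)) F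
      \<le> L2_set (\<lambda>\<alpha>. norm (word_map U (ell2_coord f) \<alpha>)) (\<Union>k\<le>N. ?W k)"
    unfolding L2_set_def using fin by (intro real_sqrt_le_mono sum_mono2) auto
  also have "\<dots> = L2_set (\<lambda>\<alpha>. norm (ell2_coord f \<alpha>)) (\<Union>k\<le>N. ?W k)"
    unfolding L2_set_def split word_map_norm_sq[OF U] ..
  also have "\<dots> \<le> norm f" by (rule L2_coord_le[OF fin])
  finally show ?thesis .
qed

lemma ell2_eqI: "(\<And>i. ell2_coord f i = ell2_coord g i) \<Longrightarrow> f = g"
  by (simp add: ell2_coord_inject[symmetric] fun_eq_iff)

lemma ell2_coord_sum: "ell2_coord (\<Sum>i\<in>I. h i) \<alpha> = (\<Sum>i\<in>I. ell2_coord (h i) \<alpha>)"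
  by (induction I rule: infinite_finite_induct) (auto simp: zero_ell2.rep_eq plus_ell2.rep_eq)

text \<open>A uniform bound on finite subsets guarantees square-summability, so that
  \<open>Abs_ell2\<close> does not yield a junk value.\<close>

lemma ell2_coord_Abs:
  assumes "\<And>F. finite F \<Longrightarrow> L2_set (\<lambda>i. norm (f i)) F \<le> M"
  shows "ell2_coord (Abs_ell2 f) = f"
  using L2_bound(1)[of f M] assms by (intro Abs_ell2_inverse) blast

section \<open>The second quantization as a unitary operator\<close>

text \<open>If \<open>U\<close> is not unitary, the image of a square-summable family need not be square-summable, and
  \<open>Abs_ell2\<close> and \<open>Blinfun\<close> yield junk values.\<close>

definition gauge_op :: "complex ^ 'n ^ 'n \<Rightarrow> ('n::finite list, 'h::complex_inner) ell2 \<Rightarrow>\<^sub>L ('n list, 'h) ell2" where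
  "gauge_op U = Blinfun (\<lambda>f. Abs_ell2 (word_map U (ell2_coord f)))"

context
  fixes U :: "complex ^ 'n ^ 'n::finite"
  assumes U: "U \<in> unitaries"
begin

lemma gauge_op_coord: "ell2_coord (gauge_op U f) \<alpha> = word_map U (ell2_coord f) \<alpha>"
  for f :: "('n list, 'h::complex_inner) ell2"
proof -
  let ?g = "\<lambda>f :: ('n list, 'h) ell2. Abs_ell2 (word_map U (ell2_coord f))"
  have c: "ell2_coord (?g f) = word_map U (ell2_coord f)" for f
    by (rule ell2_coord_Abs) (rule word_map_L2_le[OF U])
  have "bounded_linear ?g"
  proof (rule bounded_linear_intro[where K = 1])
    show "?g (f + h) = ?g f + ?g h" for f h
      by (rule ell2_eqI) (simp only: c, simp add: c plus_ell2.rep_eq word_map_add)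
    show "?g (r *\<^sub>R f) = r *\<^sub>R ?g f" for f r
      by (rule ell2_eqI) (simp only: c, simp add: c scaleC_ell2.rep_eq scaleC_of_real[symmetric] word_map_scaleC)
    show "norm (?g f) \<le> norm f * 1" for f
      using word_map_L2_le[OF U, of _ f] by (auto intro: norm_ell2_le simp: c)
  qed
  then show ?thesis by (simp add: gauge_op_def bounded_linear_Blinfun_apply c)
qed

lemma gauge_op_norm_le: "norm (gauge_op U f) \<le> norm (f :: ('n list, 'h::complex_inner) ell2)"
  using word_map_L2_le[OF U, of _ f] by (auto intro: norm_ell2_le simp: gauge_op_coord)

lemma gauge_op_scaleC: "gauge_op U (c *\<^sub>C f) = c *\<^sub>C (gauge_op U f :: ('n list, 'h::complex_inner) ell2)"
  by (rule ell2_eqI) (simp add: gauge_op_coord scaleC_ell2.rep_eq word_map_scaleC)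

lemma gauge_op_vacuum: "gauge_op U vacuum = vacuum"
proof (rule ell2_eqI)
  fix \<alpha> :: "'n list"
  show "ell2_coord (gauge_op U vacuum) \<alpha> = ell2_coord vacuum \<alpha>"
    by (cases \<alpha>) (simp_all add: gauge_op_coord vacuum.rep_eq word_map_zero)
qed

lemma gauge_op_tensor: "gauge_op U (tensor \<xi> x) = tensor (gauge_op U \<xi>) (x :: 'h::complex_inner)"
proof (rule ell2_eqI)
  fix \<alpha>
  have "word_map U (\<lambda>\<beta>. ell2_coord \<xi> \<beta> *\<^sub>C x) \<alpha> = word_map U (ell2_coord \<xi>) \<alpha> *\<^sub>C x"
    by (rule word_map_comp) (simp_all add: scaleC_add_left scaleC_scaleC scaleC_complex_def)
  then show "ell2_coord (gauge_op U (tensor \<xi> x)) \<alpha> = ell2_coord (tensor (gauge_op U \<xi>) x) \<alpha>"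
    by (simp add: gauge_op_coord tensor.rep_eq)
qed

text \<open>\<Gamma> acts on the first letter through \<open>U\<close> and on the rest of the word
  again as \<Gamma>. This is the relation that makes conjugation by \<Gamma> act on the generators
  as required.\<close>

lemma gauge_op_left_creation:
  "gauge_op U (left_creation j \<xi>) = (\<Sum>i\<in>UNIV. U $ i $ j *\<^sub>C left_creation i (gauge_op U \<xi>))"
proof (rule ell2_eqI)
  fix \<alpha>
  show "ell2_coord (gauge_op U (left_creation j \<xi>)) \<alpha>
      = ell2_coord (\<Sum>i\<in>UNIV. U $ i $ j *\<^sub>C left_creation i (gauge_op U \<xi>)) \<alpha>"
  proof (cases \<alpha>)
    case Nil
    then show ?thesis
      by (simp add: ell2_coord_sum gauge_op_coord scaleC_ell2.rep_eq left_creation.rep_eq tensor_left.rep_eq)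
  next
    case (Cons i \<beta>)
    have "word_map U (\<lambda>\<beta>. axis j (1 :: complex) $ l * ell2_coord \<xi> \<beta>) \<beta>
        = axis j 1 $ l *\<^sub>C word_map U (ell2_coord \<xi>) \<beta>" for l
      by (subst word_map_scaleC[symmetric]) (simp add: scaleC_complex_def)
    \<comment> \<open>Both sums collapse by the Kronecker delta hidden in \<open>axis\<close>: the
      first runs over the letter that \<open>U\<close> replaces, the second over the creation
      operators.\<close>
    moreover have "(\<Sum>l\<in>UNIV. U $ i $ l * (axis j 1 $ l * w)) = U $ i $ j * w"
      and "(\<Sum>l\<in>UNIV. U $ l $ j * (axis l 1 $ i * w)) = U $ i $ j * w" for w
      by (simp_all add: axis_def mult.assoc[symmetric] sum_distrib_right[symmetric]
          if_distrib[where f = "\<lambda>x. U $ _ $ _ * x"] cong: if_cong)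
    ultimately show ?thesis
      using Cons by (simp add: ell2_coord_sum gauge_op_coord scaleC_ell2.rep_eq left_creation.rep_eq
          tensor_left.rep_eq scaleC_complex_def)
  qed
qed

end

lemma gauge_op_ctrans:
  assumes U: "U \<in> unitaries"
  shows "gauge_op U (gauge_op (ctrans U) f) = (f :: ('n::finite list, 'h::complex_inner) ell2)"
proof (rule ell2_eqI)
  fix \<alpha>
  have "ell2_coord (gauge_op (ctrans U) f) = word_map (ctrans U) (ell2_coord f)"
    by (rule ext) (rule gauge_op_coord[OF ctrans_unitaries[OF U]])
  then show "ell2_coord (gauge_op U (gauge_op (ctrans U) f)) \<alpha> = ell2_coord f \<alpha>"
    using U by (simp add: gauge_op_coord word_map_mult unitaries_iff word_map_one)
qed

lemma gauge_op_norm: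
  assumes U: "U \<in> unitaries"
  shows "norm (gauge_op U f) = norm (f :: ('n::finite list, 'h::complex_inner) ell2)"
  using gauge_op_norm_le[OF U, of f] gauge_op_norm_le[OF ctrans_unitaries[OF U], of "gauge_op U f"]
    gauge_op_ctrans[OF ctrans_unitaries[OF U], of f] by simp

text \<open>An isometry preserves real parts of inner products by polarization, and imaginary parts
  after multiplication by \<open>\<i>\<close>. Since \<open>gauge_op (ctrans U)\<close> is a right
  inverse, it is the adjoint.\<close>

lemma cinner_gauge_op:
  assumes U: "U \<in> unitaries"
  shows "cinner (gauge_op U f) g = cinner f (gauge_op (ctrans U) (g :: ('n::finite list, 'h::complex_inner) ell2))"
proof -
  have re: "Re (cinner (gauge_op U f) (gauge_op U h)) = Re (cinner f h)" for f h :: "('n list, 'h) ell2"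
    using norm_add_sq[of f h] norm_add_sq[of "gauge_op U f" "gauge_op U h"]
    by (simp add: blinfun.add_right[symmetric] gauge_op_norm[OF U])
  have "cinner (gauge_op U f) (gauge_op U h) = cinner f h" for h
    using re[of f h] re[of "\<i> *\<^sub>C f" h]
    by (simp add: complex_eq_iff gauge_op_scaleC[OF U] cinner_scaleC_left)
  from this[of "gauge_op (ctrans U) g"] show ?thesis by (simp add: gauge_op_ctrans[OF U])
qed

section \<open>The gauge automorphism\<close>

lemma closed_bounded_ops: "closed (bounded_ops :: ('a::complex_inner \<Rightarrow>\<^sub>L 'b::complex_inner) set)"
proof -
  have "closed {A :: 'a \<Rightarrow>\<^sub>L 'b. A (c *\<^sub>C x) = c *\<^sub>C A x}" for c x
    by (intro closed_Collect_eq continuous_intros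
        bounded_linear.continuous_on[OF bounded_linear_scaleC])
  then show ?thesis
    unfolding bounded_ops_def by (intro closed_Collect_all)
qed

lemma op_subalgebra_bounded_ops: "op_subalgebra bounded_ops"
  by (auto simp: op_subalgebra_def bounded_ops_def blinfun.add_left scaleC_add_right
      scaleC_blinfun.rep_eq scaleC_scaleC mult.commute)

lemma id_blinfun_bounded_ops: "id_blinfun \<in> bounded_ops"
  by (simp add: bounded_ops_def)

lemma left_creation_bounded_ops: "left_creation i \<in> bounded_ops"
proof -
  have "tensor_left v (c *\<^sub>C \<xi>) = c *\<^sub>C tensor_left v \<xi>" for v :: "complex ^ 'a" and c \<xi>
    by transfer (auto simp: scaleC_complex_def)
  then show ?thesis by (simp add: bounded_ops_def left_creation.rep_eq)
qed

text \<open>The induction principle for the disc algebra: \<open>B\<close> is taken to be the set of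
  operators with the desired property.\<close>

lemma disc_algebra_subset:
  "op_subalgebra B \<Longrightarrow> closed B \<Longrightarrow> id_blinfun \<in> B \<Longrightarrow> range left_creation \<subseteq> B \<Longrightarrow> disc_algebra \<subseteq> B"
  unfolding disc_algebra_def by blast

lemma op_subalgebra_Inter: "(\<And>B. B \<in> \<B> \<Longrightarrow> op_subalgebra B) \<Longrightarrow> op_subalgebra (\<Inter>\<B>)"
  unfolding op_subalgebra_def by blast

lemma op_subalgebra_disc_algebra: "op_subalgebra disc_algebra"
  unfolding disc_algebra_def by (rule op_subalgebra_Inter) blast

lemma closed_disc_algebra: "closed disc_algebra"
  unfolding disc_algebra_def by (rule closed_Inter) blast

lemma id_in_disc_algebra: "id_blinfun \<in> disc_algebra"
  unfolding disc_algebra_def by blast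

lemma left_creation_in_disc_algebra: "left_creation i \<in> disc_algebra"
  unfolding disc_algebra_def by blast

lemma disc_algebra_bounded_ops: "A \<in> disc_algebra \<Longrightarrow> A \<in> bounded_ops"
  using disc_algebra_subset[OF op_subalgebra_bounded_ops closed_bounded_ops id_blinfun_bounded_ops]
    left_creation_bounded_ops by blast

lemma op_subalgebra_sum:
  assumes "op_subalgebra B" "\<And>i. i \<in> I \<Longrightarrow> A i \<in> B"
  shows "(\<Sum>i\<in>I. A i) \<in> B"
  using assms by (induction I rule: infinite_finite_induct) (auto simp: op_subalgebra_def)

lemma op_subalgebra_scaleC: "op_subalgebra B \<Longrightarrow> X \<in> B \<Longrightarrow> c *\<^sub>C X \<in> B"
  by (simp add: op_subalgebra_def)

lemma op_subalgebra_diff: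
  assumes "op_subalgebra B" "X \<in> B" "Y \<in> B"
  shows "X - Y \<in> B"
proof -
  have eq: "X - Y = X + (-1) *\<^sub>C Y"
    by (rule blinfun_eqI)
      (simp add: blinfun.diff_left blinfun.add_left scaleC_blinfun.rep_eq scaleC_minus_left)
  show ?thesis unfolding eq using assms by (simp add: op_subalgebra_def)
qed

text \<open>Used to read off plain isometry, and with it continuity, from complete isometry.\<close>

lemma op_matrix_norm_1: "op_matrix_norm 1 X = norm (X 0 0)"
proof -
  let ?S = "{L2_set (\<lambda>p. norm (\<Sum>q<1. X p q (x q))) {..<1} | x. L2_set (\<lambda>q. norm (x q)) {..<1 :: nat} \<le> 1}"
  have S: "?S = {norm (X 0 0 x) | x. norm x \<le> 1}"
    by (auto simp: lessThan_Suc)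
  have le: "norm (X 0 0 x) \<le> norm (X 0 0)" if "norm x \<le> 1" for x
    using norm_blinfun[of "X 0 0" x] mult_left_mono[OF that, of "norm (X 0 0)"] by simp
  have bdd: "bdd_above {norm (X 0 0 x) | x. norm x \<le> 1}"
    using le by (auto intro!: bdd_aboveI[where M = "norm (X 0 0)"])
  have "Sup {norm (X 0 0 x) | x. norm x \<le> 1} \<le> norm (X 0 0)"
    by (rule cSup_least) (use le in \<open>auto intro: exI[of _ 0]\<close>)
  moreover have "norm (X 0 0) \<le> Sup {norm (X 0 0 x) | x. norm x \<le> 1}" (is "_ \<le> ?s")
  proof (rule norm_blinfun_bound)
    have "norm (X 0 0 0) \<le> ?s" by (rule cSup_upper[OF _ bdd]) (auto intro!: exI[of _ 0])
    then show "0 \<le> ?s" by simp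
    fix x
    show "norm (X 0 0 x) \<le> ?s * norm x"
    proof (cases "x = 0")
      case False
      have "norm (X 0 0 (x /\<^sub>R norm x)) \<le> ?s"
        by (rule cSup_upper[OF _ bdd]) (use False in \<open>auto intro!: exI[of _ "x /\<^sub>R norm x"]\<close>)
      then show ?thesis using False by (simp add: blinfun.scaleR_right divide_simps)
    qed simp
  qed
  ultimately show ?thesis unfolding op_matrix_norm_def S by simp
qed

section \<open>Conjugation by the second quantization\<close>

definition gauge_conj :: "complex ^ 'n ^ 'n \<Rightarrow> ('n::finite fock \<Rightarrow>\<^sub>L 'n fock) \<Rightarrow> 'n fock \<Rightarrow>\<^sub>L 'n fock" where
  "gauge_conj U A = gauge_op U o\<^sub>L A o\<^sub>L gauge_op (ctrans U)"

lemma gauge_conj_apply: "gauge_conj U A \<xi> = gauge_op U (A (gauge_op (ctrans U) \<xi>))"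
  by (simp add: gauge_conj_def)

lemma gauge_conj_add: "gauge_conj U (A + B) = gauge_conj U A + gauge_conj U B"
  by (rule blinfun_eqI) (simp add: gauge_conj_apply blinfun.add_left blinfun.add_right)

lemma continuous_gauge_conj: "continuous_on S (gauge_conj U)"
  unfolding gauge_conj_def by (intro continuous_intros)

context
  fixes U :: "complex ^ 'n ^ 'n::finite"
  assumes U: "U \<in> unitaries"
begin

lemma gauge_op_ctrans': "gauge_op (ctrans U) (gauge_op U f) = (f :: ('n list, 'h::complex_inner) ell2)"
  using gauge_op_ctrans[OF ctrans_unitaries[OF U]] by simp

lemma gauge_conj_id: "gauge_conj U id_blinfun = id_blinfun"
  by (rule blinfun_eqI) (simp add: gauge_conj_apply gauge_op_ctrans[OF U])

lemma gauge_conj_compose: "gauge_conj U (A o\<^sub>L B) = gauge_conj U A o\<^sub>L gauge_conj U B"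
  by (rule blinfun_eqI) (simp add: gauge_conj_apply gauge_op_ctrans')

lemma gauge_conj_scaleC: "gauge_conj U (c *\<^sub>C A) = c *\<^sub>C gauge_conj U A"
  by (rule blinfun_eqI) (simp add: gauge_conj_apply scaleC_blinfun.rep_eq gauge_op_scaleC[OF U])

lemma gauge_conj_ctrans: "gauge_conj (ctrans U) (gauge_conj U A) = A"
  by (rule blinfun_eqI) (simp add: gauge_conj_apply gauge_op_ctrans')

lemma gauge_conj_left_creation:
  "gauge_conj U (left_creation j) = (\<Sum>i\<in>UNIV. U $ i $ j *\<^sub>C left_creation i)"
  by (rule blinfun_eqI)
    (simp add: gauge_conj_apply gauge_op_left_creation[OF U] gauge_op_ctrans[OF U]
      blinfun.sum_left scaleC_blinfun.rep_eq)

text \<open>The preimage of the disc algebra under conjugation is again a closed unital subalgebra,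
  and it contains the generators because their images are linear combinations of generators.\<close>

lemma gauge_conj_disc_algebra: "A \<in> disc_algebra \<Longrightarrow> gauge_conj U A \<in> disc_algebra"
proof -
  have "disc_algebra \<subseteq> gauge_conj U -` disc_algebra"
  proof (rule disc_algebra_subset)
    have "gauge_conj U 0 = 0" by (simp add: gauge_conj_def)
    then show "op_subalgebra (gauge_conj U -` disc_algebra)"
      using op_subalgebra_disc_algebra
      by (auto simp: op_subalgebra_def gauge_conj_add gauge_conj_compose gauge_conj_scaleC)
    show "closed (gauge_conj U -` disc_algebra)"
      by (intro closed_vimage closed_disc_algebra continuous_gauge_conj)
    show "id_blinfun \<in> gauge_conj U -` disc_algebra"
      by (simp add: gauge_conj_id id_in_disc_algebra)
    show "range left_creation \<subseteq> gauge_conj U -` disc_algebra"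
      by (auto simp: gauge_conj_left_creation intro!: op_subalgebra_sum op_subalgebra_scaleC
          op_subalgebra_disc_algebra left_creation_in_disc_algebra)
  qed
  then show "A \<in> disc_algebra \<Longrightarrow> gauge_conj U A \<in> disc_algebra" by blast
qed

end

text \<open>Applying the inverse of \<Gamma> to every entry of a test vector preserves the unit
  ball, and the outer \<Gamma> does not change norms. This gives one inclusion of the sets of
  values; the other is the same statement for \<open>ctrans U\<close>.\<close>

lemma op_matrix_norm_gauge_conj:
  fixes U :: "complex ^ 'n ^ 'n::finite"
  assumes U: "U \<in> unitaries"
  shows "op_matrix_norm k (\<lambda>p q. gauge_conj U (X p q)) = op_matrix_norm k X"
proof -
  let ?S = "\<lambda>X. {L2_set (\<lambda>p. norm (\<Sum>q<k. blinfun_apply (X p q) (x q))) {..<k} | x.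
      L2_set (\<lambda>q. norm (x q)) {..<k} \<le> 1}"
  have sub: "?S (\<lambda>p q. gauge_conj V (X p q)) \<subseteq> ?S X"
    if V: "V \<in> unitaries" for V and X :: "nat \<Rightarrow> nat \<Rightarrow> 'n fock \<Rightarrow>\<^sub>L 'n fock"
  proof
    fix a assume "a \<in> ?S (\<lambda>p q. gauge_conj V (X p q))"
    then obtain x where x: "L2_set (\<lambda>q. norm (x q)) {..<k} \<le> 1"
      and a: "a = L2_set (\<lambda>p. norm (\<Sum>q<k. gauge_conj V (X p q) (x q))) {..<k}" by blast
    define y where "y q = gauge_op (ctrans V) (x q)" for q
    have "a = L2_set (\<lambda>p. norm (\<Sum>q<k. X p q (y q))) {..<k}"
      unfolding a gauge_conj_apply y_def blinfun.sum_right[symmetric] gauge_op_norm[OF V] ..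
    moreover have "L2_set (\<lambda>q. norm (y q)) {..<k} \<le> 1"
      using x by (simp add: y_def gauge_op_norm ctrans_unitaries V)
    ultimately show "a \<in> ?S X" by blast
  qed
  have "?S X = ?S (\<lambda>p q. gauge_conj (ctrans U) (gauge_conj U (X p q)))"
    by (simp add: gauge_conj_ctrans[OF U])
  also have "\<dots> \<subseteq> ?S (\<lambda>p q. gauge_conj U (X p q))"
    by (rule sub[OF ctrans_unitaries[OF U]])
  finally have "?S (\<lambda>p q. gauge_conj U (X p q)) = ?S X" using sub[OF U, of X] by blast
  then show ?thesis by (simp only: op_matrix_norm_def)
qed

section \<open>Uniqueness of the gauge automorphism\<close>

lemma algebra_automorphism_add:
  "algebra_automorphism B \<phi> \<Longrightarrow> X \<in> B \<Longrightarrow> Y \<in> B \<Longrightarrow> \<phi> (X + Y) = \<phi> X + \<phi> Y"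
  by (simp add: algebra_automorphism_def)

text \<open>The set where the two maps agree is a subalgebra containing the generators; it is closed
  since complete isometry at size 1 makes both maps continuous.\<close>

lemma automorphism_unique:
  fixes \<phi> \<psi> :: "('n::finite fock \<Rightarrow>\<^sub>L 'n fock) \<Rightarrow> 'n fock \<Rightarrow>\<^sub>L 'n fock"
  assumes \<phi>: "algebra_automorphism disc_algebra \<phi>" "completely_isometric_on disc_algebra \<phi>"
    and \<psi>: "algebra_automorphism disc_algebra \<psi>" "completely_isometric_on disc_algebra \<psi>"
    and eq: "\<And>j. \<phi> (left_creation j) = \<psi> (left_creation j)" and X: "X \<in> disc_algebra"
  shows "\<phi> X = \<psi> X"
proof -
  let ?D = "disc_algebra :: ('n fock \<Rightarrow>\<^sub>L 'n fock) set"
  have cont: "continuous_on ?D f"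
    if f: "algebra_automorphism ?D f" "completely_isometric_on ?D f" for f
  proof -
    have iso: "norm (f X) = norm X" if "X \<in> ?D" for X
    proof -
      have "op_matrix_norm 1 (\<lambda>p q. f X) = op_matrix_norm 1 (\<lambda>p q. X)"
        using f(2)[unfolded completely_isometric_on_def, rule_format, of 1 "\<lambda>p q. X"] that by simp
      then show ?thesis unfolding op_matrix_norm_1 .
    qed
    have "dist (f X) (f Y) = dist X Y" if X: "X \<in> ?D" and Y: "Y \<in> ?D" for X Y
    proof -
      have XY: "X - Y \<in> ?D" by (rule op_subalgebra_diff[OF op_subalgebra_disc_algebra X Y])
      \<comment> \<open>Automorphisms are postulated to be additive only, so differences are treated
        by adding \<open>Y\<close> back.\<close>
      have "f ((X - Y) + Y) = f (X - Y) + f Y"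
        by (rule algebra_automorphism_add[OF f(1) XY Y])
      then have "f X - f Y = f (X - Y)" by simp
      then show ?thesis by (simp add: dist_norm iso[OF XY])
    qed
    then show ?thesis unfolding continuous_on_iff by auto
  qed
  let ?B = "{X \<in> ?D. \<phi> X = \<psi> X}"
  have "?D \<subseteq> ?B"
  proof (rule disc_algebra_subset)
    have zero: "f 0 = 0" if "algebra_automorphism ?D f" for f
    proof -
      have "0 \<in> ?D" using op_subalgebra_disc_algebra[where 'a = 'n] by (simp add: op_subalgebra_def)
      then have "f (0 + 0) = f 0 + f 0" using algebra_automorphism_add[OF that] by blast
      then show ?thesis by simp
    qed
    show "op_subalgebra ?B"
      using \<phi>(1) \<psi>(1) zero[OF \<phi>(1)] zero[OF \<psi>(1)] op_subalgebra_disc_algebra[where 'a = 'n]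
      unfolding op_subalgebra_def algebra_automorphism_def by simp
    show "closed ?B"
    proof -
      have "?B = ?D \<inter> (\<lambda>X. \<phi> X - \<psi> X) -` {0}" by auto
      moreover have "closed (?D \<inter> (\<lambda>X. \<phi> X - \<psi> X) -` {0})"
        by (intro continuous_closed_preimage continuous_on_diff cont \<phi> \<psi> closed_disc_algebra) simp
      ultimately show ?thesis by simp
    qed
    show "id_blinfun \<in> ?B"
      using \<phi>(1) \<psi>(1) by (simp add: id_in_disc_algebra algebra_automorphism_def)
    show "range left_creation \<subseteq> ?B" using eq by (auto simp: left_creation_in_disc_algebra)
  qed
  then show ?thesis using X by blast
qed

text \<open>Conjugation by \<Gamma>, restricted so as to be extensional, satisfies every clause of
  the description, and \<open>automorphism_unique\<close> excludes other solutions.\<close>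

lemma gauge_automorphism_eq:
  assumes U: "U \<in> unitaries" and A: "A \<in> disc_algebra"
  shows "gauge_automorphism U A = gauge_conj U A"
proof -
  let ?\<phi> = "restrict (gauge_conj U) disc_algebra"
  let ?P = "\<lambda>\<phi>. \<phi> \<in> extensional disc_algebra \<and>
    algebra_automorphism disc_algebra \<phi> \<and> completely_isometric_on disc_algebra \<phi> \<and>
    (\<forall>j. \<phi> (left_creation j) = (\<Sum>i\<in>UNIV. U $ i $ j *\<^sub>C left_creation i))"
  note U' = ctrans_unitaries[OF U]
  have bij: "bij_betw ?\<phi> disc_algebra disc_algebra"
    by (rule bij_betw_byWitness[where f' = "gauge_conj (ctrans U)"])
      (use gauge_conj_ctrans[OF U'] in \<open>auto simp: gauge_conj_ctrans[OF U] gauge_conj_disc_algebra U U'\<close>)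
  have P: "?P ?\<phi>"
  proof (intro conjI allI)
    show "algebra_automorphism disc_algebra ?\<phi>"
      using op_subalgebra_disc_algebra bij
      by (auto simp: algebra_automorphism_def op_subalgebra_def id_in_disc_algebra gauge_conj_id[OF U]
          gauge_conj_add gauge_conj_compose[OF U] gauge_conj_scaleC[OF U])
    show "completely_isometric_on disc_algebra ?\<phi>"
      unfolding completely_isometric_on_def
    proof (intro allI impI)
      fix k and X :: "nat \<Rightarrow> nat \<Rightarrow> 'a fock \<Rightarrow>\<^sub>L 'a fock"
      assume X: "\<forall>p<k. \<forall>q<k. X p q \<in> disc_algebra"
      have "L2_set (\<lambda>p. norm (\<Sum>q<k. ?\<phi> (X p q) (x q))) {..<k}
          = L2_set (\<lambda>p. norm (\<Sum>q<k. gauge_conj U (X p q) (x q))) {..<k}" for x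
        using X by (intro L2_set_cong refl arg_cong[where f = norm] sum.cong) auto
      then have "op_matrix_norm k (\<lambda>p q. ?\<phi> (X p q)) = op_matrix_norm k (\<lambda>p q. gauge_conj U (X p q))"
        by (simp only: op_matrix_norm_def)
      then show "op_matrix_norm k (\<lambda>p q. ?\<phi> (X p q)) = op_matrix_norm k X"
        by (simp only: op_matrix_norm_gauge_conj[OF U])
    qed
    show "?\<phi> (left_creation j) = (\<Sum>i\<in>UNIV. U $ i $ j *\<^sub>C left_creation i)" for j
      by (simp add: left_creation_in_disc_algebra gauge_conj_left_creation[OF U])
  qed simp
  have "gauge_automorphism U = ?\<phi>"
    unfolding gauge_automorphism_def
  proof (rule the_equality[of ?P, OF P])
    fix \<psi> assume \<psi>: "?P \<psi>"
    show "\<psi> = ?\<phi>"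
    proof (rule extensionalityI[of _ disc_algebra])
      show "\<psi> X = ?\<phi> X" if "X \<in> disc_algebra" for X
        by (rule automorphism_unique[where \<phi> = \<psi> and \<psi> = ?\<phi>]) (use \<psi> P that in auto)
    qed (use \<psi> in auto)
  qed
  then show ?thesis using A by simp
qed

section \<open>Tensor products of operators with the identity\<close>

lemma tensor_add_left: "tensor (\<xi> + \<eta>) x = tensor \<xi> x + tensor \<eta> x"
  by transfer (simp add: scaleC_add_left)

lemma tensor_add_right: "tensor \<xi> (x + y) = tensor \<xi> x + tensor \<xi> y"
  by transfer (simp add: scaleC_add_right)

lemma tensor_scaleC_left: "tensor (c *\<^sub>C \<xi>) x = c *\<^sub>C tensor \<xi> x"
  by transfer (simp add: scaleC_scaleC scaleC_complex_def)

lemma tensor_scaleC_right: "tensor \<xi> (c *\<^sub>C x) = c *\<^sub>C tensor \<xi> x"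
  by transfer (simp add: scaleC_scaleC mult.commute)

lemma tensor_zero_left [simp]: "tensor 0 x = 0"
  by transfer simp

lemma tensor_zero_right [simp]: "tensor \<xi> 0 = 0"
  by transfer simp

lemma norm_tensor: "norm (tensor \<xi> x) = norm \<xi> * norm x"
proof -
  have "complex_of_real ((norm (tensor \<xi> x))\<^sup>2) = complex_of_real ((norm \<xi> * norm x)\<^sup>2)"
    by (simp only: cinner_self[symmetric] cinner_tensor) (simp add: cinner_self power_mult_distrib)
  then have "(norm (tensor \<xi> x))\<^sup>2 = (norm \<xi> * norm x)\<^sup>2"
    using of_real_eq_iff by blast
  then show ?thesis by (simp add: power2_eq_iff_nonneg)
qed

lemma tensor_sum_left: "tensor (\<Sum>i\<in>I. f i) x = (\<Sum>i\<in>I. tensor (f i) x)"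
  by (induction I rule: infinite_finite_induct) (auto simp: tensor_add_left)

lemma bounded_linear_tensor_vec: "bounded_linear (\<lambda>\<xi>. tensor \<xi> x)"
  by (rule bounded_linear_intro[where K = "norm x"])
    (auto simp: tensor_add_left tensor_scaleC_left scaleC_of_real[symmetric] norm_tensor)

text \<open>By induction on the number of summands: one vector \<open>x\<^sub>k\<close> is split off by making the others
  orthogonal to it, after which Pythagoras applies on both sides.\<close>

lemma norm_sum_tensor_apply_le:
  fixes A :: "('i, complex) ell2 \<Rightarrow>\<^sub>L ('i, complex) ell2"
    and a :: "'j \<Rightarrow> ('i, complex) ell2" and x :: "'j \<Rightarrow> 'h::complex_inner"
  assumes A: "A \<in> bounded_ops" and J: "finite J"
  shows "norm (\<Sum>j\<in>J. tensor (blinfun_apply A (a j)) (x j)) \<le> norm A * norm (\<Sum>j\<in>J. tensor (a j) (x j))"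
  using J
proof (induction J arbitrary: a x)
  case empty
  then show ?case by simp
next
  case (insert k J)
  show ?case
  proof (cases "x k = 0")
    case True
    then show ?thesis using insert by simp
  next
    case False
    \<comment> \<open>The part of \<open>x j\<close> along \<open>x k\<close>; \<open>y j\<close> is
      the orthogonal remainder.\<close>
    define c where "c j = cinner (x j) (x k) / cinner (x k) (x k)" for j
    define y where "y j = x j - c j *\<^sub>C x k" for j
    have kk: "cinner (x k) (x k) \<noteq> 0" using False by (simp add: cinner_self)
    have "cinner (y j) (x k) = 0" for j
      using kk by (simp add: y_def cinner_diff_left cinner_scaleC_left c_def)
    then have orth: "cinner (x k) (y j) = 0" for j
      by (subst cinner_commute) simp
    have x: "x j = c j *\<^sub>C x k + y j" for j by (simp add: y_def)
    \<comment> \<open>Stated for arbitrary \<open>b\<close>, so that it serves both \<open>a\<close>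
      and its image under \<open>A\<close> with the same coefficients \<open>c\<close>.\<close>
    have split: "(\<Sum>j\<in>insert k J. tensor (b j) (x j))
        = tensor (b k + (\<Sum>j\<in>J. c j *\<^sub>C b j)) (x k) + (\<Sum>j\<in>J. tensor (b j) (y j))"
      for b :: "'j \<Rightarrow> ('i, complex) ell2"
    proof -
      have "(\<Sum>j\<in>J. tensor (b j) (x j)) = (\<Sum>j\<in>J. tensor (c j *\<^sub>C b j) (x k) + tensor (b j) (y j))"
        by (rule sum.cong[OF refl], subst x)
          (simp add: tensor_add_right tensor_scaleC_right tensor_scaleC_left)
      then show ?thesis
        using insert.hyps by (simp add: tensor_add_left tensor_sum_left sum.distrib)
    qed
    have pyth: "(norm (tensor b (x k) + (\<Sum>j\<in>J. tensor (d j) (y j))))\<^sup>2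
        = (norm b * norm (x k))\<^sup>2 + (norm (\<Sum>j\<in>J. tensor (d j) (y j)))\<^sup>2"
      for b :: "('i, complex) ell2" and d
      unfolding norm_add_sq by (simp add: cinner_sum_right cinner_tensor orth norm_tensor)
    define b where "b = a k + (\<Sum>j\<in>J. c j *\<^sub>C a j)"
    have Ab: "A (a k) + (\<Sum>j\<in>J. c j *\<^sub>C A (a j)) = A b"
      using A by (simp add: b_def blinfun.add_right blinfun.sum_right bounded_ops_def)
    have "(norm (\<Sum>j\<in>insert k J. tensor (A (a j)) (x j)))\<^sup>2
        = (norm (A b) * norm (x k))\<^sup>2 + (norm (\<Sum>j\<in>J. tensor (A (a j)) (y j)))\<^sup>2"
      using split[of "\<lambda>j. A (a j)"] by (simp only: Ab pyth)
    also have "\<dots> \<le> (norm A * norm b * norm (x k))\<^sup>2 + (norm A * norm (\<Sum>j\<in>J. tensor (a j) (y j)))\<^sup>2"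
      by (intro add_mono power_mono mult_right_mono norm_blinfun insert.IH) auto
    also have "\<dots> = (norm A)\<^sup>2 * ((norm b * norm (x k))\<^sup>2 + (norm (\<Sum>j\<in>J. tensor (a j) (y j)))\<^sup>2)"
      by (simp add: power_mult_distrib algebra_simps)
    also have "\<dots> = (norm A * norm (\<Sum>j\<in>insert k J. tensor (a j) (x j)))\<^sup>2"
      using split[of a] by (simp only: power_mult_distrib[of "norm A"] b_def[symmetric] pyth)
    finally show ?thesis by (rule power2_le_imp_le) simp
  qed
qed

section \<open>Unordered sums and the orthonormal expansion\<close>

text \<open>Cauchy criterion for sums that converge by orthogonality and possibly not absolutely:
  finite sums of \<open>t\<close> off a large set are controlled by the tail of
  \<open>g\<close>.\<close>

lemma summable_on_sq_bound:
  fixes t :: "'i \<Rightarrow> 'b::banach" and g :: "'i \<Rightarrow> real"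
  assumes g: "g summable_on UNIV"
    and bound: "\<And>G. finite G \<Longrightarrow> (norm (sum t G))\<^sup>2 \<le> C * sum g G"
  shows "t summable_on UNIV"
proof -
  have "\<exists>P. eventually P (finite_subsets_at_top UNIV) \<and> (\<forall>X Y. P X \<and> P Y \<longrightarrow> dist (sum t X) (sum t Y) < e)"
    if e: "e > 0" for e
  proof -
    define K where "K = \<bar>C\<bar> + 1"
    have K: "K > 0" by (simp add: K_def add_nonneg_pos)
    \<comment> \<open>Chosen so that \<open>K * (2 * d)\<close> is e^2 / 8, below the square of
      \<open>e / 2\<close>.\<close>
    define d where "d = e\<^sup>2 / (16 * K)"
    have d: "d > 0" using e K by (simp add: d_def)
    have "(sum g \<longlongrightarrow> infsum g UNIV) (finite_subsets_at_top UNIV)"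
      using g has_sum_infsum has_sum_def by blast
    then have "\<forall>\<^sub>F F in finite_subsets_at_top UNIV. dist (sum g F) (infsum g UNIV) < d"
      using d by (rule tendstoD)
    then obtain F where F: "finite F" "\<And>X. finite X \<Longrightarrow> F \<subseteq> X \<Longrightarrow> dist (sum g X) (infsum g UNIV) < d"
      unfolding eventually_finite_subsets_at_top by auto
    have close: "dist (sum t X) (sum t F) < e / 2" if X: "finite X" "F \<subseteq> X" for X
    proof -
      have "sum g (X - F) = sum g X - sum g F" using X F(1) by (simp add: sum_diff)
      then have s: "\<bar>sum g (X - F)\<bar> < 2 * d"
        using F(2)[OF X] F(2)[OF F(1)] by (simp add: dist_real_def)
      have "(dist (sum t X) (sum t F))\<^sup>2 = (norm (sum t (X - F)))\<^sup>2"
        using X F(1) by (simp add: sum_diff dist_norm)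
      also have "\<dots> \<le> C * sum g (X - F)" using X by (intro bound) simp
      also have "\<dots> \<le> \<bar>C\<bar> * \<bar>sum g (X - F)\<bar>"
        by (metis abs_ge_self abs_mult)
      also have "\<dots> \<le> K * (2 * d)"
        using s by (intro mult_mono) (auto simp: K_def)
      also have "\<dots> < (e / 2)\<^sup>2"
        using e K by (simp add: d_def power2_eq_square)
      finally show ?thesis by (rule power2_less_imp_less) (use e in simp)
    qed
    have "eventually (\<lambda>X. finite X \<and> F \<subseteq> X) (finite_subsets_at_top UNIV)"
      unfolding eventually_finite_subsets_at_top using F(1) by blast
    moreover have "dist (sum t X) (sum t Y) < e" if "finite X \<and> F \<subseteq> X" "finite Y \<and> F \<subseteq> Y" for X Y
      using close[of X] close[of Y] that dist_triangle2[of "sum t X" "sum t Y" "sum t F"] by linarith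
    ultimately show ?thesis by blast
  qed
  then have "cauchy_filter (filtermap (sum t) (finite_subsets_at_top UNIV))"
    by (simp add: cauchy_filter_metric_filtermap)
  moreover have "complete (UNIV::'b set)"
    by (meson Cauchy_convergent UNIV_I complete_def convergent_def)
  ultimately obtain L where "(sum t \<longlongrightarrow> L) (finite_subsets_at_top UNIV)"
    using complete_uniform[where S=UNIV] by (force simp add: filterlim_def)
  then show ?thesis
    using summable_on_def has_sum_def by blast
qed

lemma bounded_linear_ell2_coord: "bounded_linear (\<lambda>f. ell2_coord f i)"
  by (rule bounded_linear_intro[where K = 1])
    (auto simp: plus_ell2.rep_eq scaleR_ell2.rep_eq norm_coord_le)

definition ell2_basis :: "'i \<Rightarrow> ('i, complex) ell2" where
  "ell2_basis i = Abs_ell2 (\<lambda>j. if j = i then 1 else 0)"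

lemma ell2_basis_coord: "ell2_coord (ell2_basis i) j = (if j = i then 1 else 0)"
proof -
  have "L2_set (\<lambda>j. cmod (if j = i then 1 else 0)) F \<le> 1" if "finite F" for F
    using that by (auto simp: L2_set_def if_distrib[of cmod] if_distrib[of "\<lambda>x. x\<^sup>2"] cong: if_cong)
  then show ?thesis unfolding ell2_basis_def by (subst ell2_coord_Abs) auto
qed

lemma norm_sum_basis_tensor:
  fixes v :: "'i \<Rightarrow> 'h::complex_inner"
  assumes G: "finite G"
  shows "(norm (\<Sum>i\<in>G. tensor (ell2_basis i) (v i)))\<^sup>2 = (\<Sum>i\<in>G. (norm (v i))\<^sup>2)"
proof -
  have "cinner (tensor (ell2_basis i) (v i)) (tensor (ell2_basis j) (v j))
      = (if j = i then cinner (v i) (v i) else 0)" for i j :: 'i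
  proof -
    have "cinner (ell2_basis i) (ell2_basis j) = (\<Sum>\<^sub>\<infinity>l\<in>{i} \<inter> {j}. 1)"
      unfolding cinner_ell2.rep_eq
      by (rule infsum_cong_neutral) (auto simp: ell2_basis_coord cinner_complex_def)
    then show ?thesis by (auto simp: cinner_tensor)
  qed
  then have "complex_of_real ((norm (\<Sum>i\<in>G. tensor (ell2_basis i) (v i)))\<^sup>2)
      = complex_of_real (\<Sum>i\<in>G. (norm (v i))\<^sup>2)"
    using G by (simp only: cinner_self[symmetric] cinner_sum_left cinner_sum_right of_real_sum)
      (simp add: sum.delta)
  then show ?thesis using of_real_eq_iff by blast
qed

text \<open>Pythagoras gives convergence; the limit is then identified coordinate by coordinate, as
  coordinates are continuous.\<close>

lemma has_sum_basis_tensor: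
  fixes f :: "('i, 'h::chilbert_space) ell2"
  shows "((\<lambda>i. tensor (ell2_basis i) (ell2_coord f i)) has_sum f) UNIV"
proof -
  let ?t = "\<lambda>i. tensor (ell2_basis i) (ell2_coord f i)"
  have "?t summable_on UNIV"
  proof (rule summable_on_sq_bound[where C = 1])
    show "(\<lambda>i. (norm (ell2_coord f i))\<^sup>2) summable_on UNIV" using ell2_coord[of f] by simp
  qed (simp add: norm_sum_basis_tensor)
  then have s: "(?t has_sum infsum ?t UNIV) UNIV" by (rule has_sum_infsum)
  moreover have "infsum ?t UNIV = f"
  proof (rule ell2_eqI)
    fix j
    have "((\<lambda>i. ell2_coord (?t i) j) has_sum ell2_coord (infsum ?t UNIV) j) UNIV"
      by (rule has_sum_bounded_linear[OF bounded_linear_ell2_coord s])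
    moreover have "((\<lambda>i. ell2_coord (?t i) j) has_sum ell2_coord f j) UNIV"
    proof -
      have "((\<lambda>i. ell2_coord (?t i) j) has_sum (\<Sum>i\<in>{j}. ell2_coord (?t i) j)) {j}"
        by (rule has_sum_finite) simp
      then show ?thesis
        by (subst has_sum_cong_neutral[where T = "{j}" and g = "\<lambda>i. ell2_coord (?t i) j"])
          (auto simp: tensor.rep_eq ell2_basis_coord)
    qed
    ultimately show "ell2_coord (infsum ?t UNIV) j = ell2_coord f j" by (rule has_sum_unique)
  qed
  ultimately show ?thesis by simp
qed

section \<open>Existence and uniqueness of tensor products of operators\<close>

lemma blinfun_tensor_ext:
  fixes C D :: "('i, 'h::complex_inner) ell2 \<Rightarrow>\<^sub>L 'b::real_normed_vector"
  assumes "\<And>\<xi> x. C (tensor \<xi> x) = D (tensor \<xi> x)"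
  shows "C = D"
proof (rule blinfun_eqI)
  fix f
  let ?E = "{f. C f = D f}"
  have "closed ?E" by (intro closed_Collect_eq continuous_intros)
  moreover have "subspace ?E"
    by (auto simp: subspace_def blinfun.add_right blinfun.scaleR_right)
  then have "span (range (case_prod tensor)) \<subseteq> ?E"
    by (rule span_minimal[rotated]) (auto simp: assms)
  ultimately have "closure (span (range (case_prod tensor))) \<subseteq> ?E" by (rule closure_minimal[rotated])
  then show "C f = D f" unfolding tensor_total by blast
qed

lemma op_tensor_eqI:
  assumes "C \<in> bounded_ops" "\<And>\<xi> x. blinfun_apply C (tensor \<xi> x) = tensor (blinfun_apply A \<xi>) (blinfun_apply B x)"
  shows "op_tensor A B = C"
  unfolding op_tensor_def
  by (rule the_equality) (use assms in \<open>auto intro: blinfun_tensor_ext\<close>)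

text \<open>\<open>op_tensor\<close> is a definite description, so a bounded solution has to be
  constructed: \<open>f\<close> is expanded along the basis and \<open>A\<close> is applied to the
  basis vectors. Convergence and the norm bound both come from
  \<open>norm_sum_tensor_apply_le\<close>.\<close>

lemma op_tensor_id_apply:
  fixes A :: "('i, complex) ell2 \<Rightarrow>\<^sub>L ('i, complex) ell2" and x :: "'h::chilbert_space"
  assumes A: "A \<in> bounded_ops"
  shows "op_tensor A id_blinfun (tensor \<xi> x) = tensor (A \<xi>) x"
proof -
  define t :: "('i, 'h) ell2 \<Rightarrow> 'i \<Rightarrow> ('i, 'h) ell2"
    where "t f i = tensor (A (ell2_basis i)) (ell2_coord f i)" for f i
  define C where "C f = infsum (t f) UNIV" for f
  have bound: "(norm (sum (t f) G))\<^sup>2 \<le> (norm A)\<^sup>2 * (\<Sum>i\<in>G. (norm (ell2_coord f i))\<^sup>2)" if "finite G" for f G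
    using power_mono[OF norm_sum_tensor_apply_le[OF A that, of ell2_basis "ell2_coord f"], of 2]
    by (simp add: t_def power_mult_distrib norm_sum_basis_tensor[OF that])
  have "t f summable_on UNIV" for f
  proof (rule summable_on_sq_bound[OF _ bound])
    show "(\<lambda>i. (norm (ell2_coord f i))\<^sup>2) summable_on UNIV" using ell2_coord[of f] by simp
  qed
  then have C: "(t f has_sum C f) UNIV" for f
    unfolding C_def by (rule has_sum_infsum)
  have C_scaleC: "C (c *\<^sub>C f) = c *\<^sub>C C f" for c f
  proof -
    have "t (c *\<^sub>C f) = (\<lambda>i. c *\<^sub>C t f i)" by (simp add: fun_eq_iff t_def scaleC_ell2.rep_eq tensor_scaleC_right)
    then show ?thesis
      using has_sum_bounded_linear[OF bounded_linear_scaleC C] C has_sum_unique by metis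
  qed
  have "bounded_linear C"
  proof (rule bounded_linear_intro[where K = "norm A"])
    show "C (f + g) = C f + C g" for f g
    proof -
      have "t (f + g) = (\<lambda>i. t f i + t g i)" by (simp add: fun_eq_iff t_def plus_ell2.rep_eq tensor_add_right)
      then show ?thesis using has_sum_add[OF C C] C has_sum_unique by metis
    qed
    show "C (r *\<^sub>R f) = r *\<^sub>R C f" for r f
      using C_scaleC[of "complex_of_real r" f] by (simp add: scaleC_of_real)
    show "norm (C f) \<le> norm f * norm A" for f
    proof (rule tendsto_upperbound)
      show "((\<lambda>G. norm (sum (t f) G)) \<longlongrightarrow> norm (C f)) (finite_subsets_at_top UNIV)"
        using C[of f] unfolding has_sum_def by (rule tendsto_norm)
      show "\<forall>\<^sub>F G in finite_subsets_at_top UNIV. norm (sum (t f) G) \<le> norm f * norm A"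
      proof (rule eventually_finite_subsets_at_top_weakI)
        fix G :: "'i set" assume G: "finite G"
        have "(\<Sum>i\<in>G. (norm (ell2_coord f i))\<^sup>2) \<le> (norm f)\<^sup>2"
          using power_mono[OF L2_coord_le[OF G, of f], of 2] by (simp add: L2_set_sq)
        then have "(norm A)\<^sup>2 * (\<Sum>i\<in>G. (norm (ell2_coord f i))\<^sup>2) \<le> (norm A)\<^sup>2 * (norm f)\<^sup>2"
          by (rule mult_left_mono) simp
        then have "(norm (sum (t f) G))\<^sup>2 \<le> (norm f * norm A)\<^sup>2"
          using bound[OF G, of f] by (simp add: power_mult_distrib mult.commute)
        then show "norm (sum (t f) G) \<le> norm f * norm A" by (rule power2_le_imp_le) simp
      qed
    qed simp
  qed
  then have BC: "blinfun_apply (Blinfun C) = C" by (rule bounded_linear_Blinfun_apply)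
  have C_tensor: "C (tensor \<xi> x) = tensor (A \<xi>) x" for \<xi> x
  proof -
    \<comment> \<open>Here the second tensor factor is the scalar field, so this is the basis
      expansion of \<xi>.\<close>
    have "((\<lambda>i. tensor (ell2_basis i) (ell2_coord \<xi> i)) has_sum \<xi>) UNIV"
      by (rule has_sum_basis_tensor)
    then have "((\<lambda>i. tensor (A (tensor (ell2_basis i) (ell2_coord \<xi> i))) x) has_sum tensor (A \<xi>) x) UNIV"
      by (intro has_sum_bounded_linear[OF bounded_linear_tensor_vec]
          has_sum_bounded_linear[OF blinfun.bounded_linear_right])
    moreover have "tensor (A (tensor (ell2_basis i) (ell2_coord \<xi> i))) x = t (tensor \<xi> x) i" for i
    proof -
      have "tensor (ell2_basis i) (ell2_coord \<xi> i) = ell2_coord \<xi> i *\<^sub>C ell2_basis i"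
        by (rule ell2_eqI) (simp add: tensor.rep_eq scaleC_ell2.rep_eq scaleC_complex_def)
      then show ?thesis
        using A by (simp add: t_def tensor.rep_eq bounded_ops_def tensor_scaleC_left tensor_scaleC_right)
    qed
    ultimately show ?thesis using C has_sum_unique by simp blast
  qed
  have "op_tensor A id_blinfun = Blinfun C"
    by (rule op_tensor_eqI) (simp_all add: bounded_ops_def BC C_scaleC C_tensor)
  then show ?thesis by (simp add: BC C_tensor)
qed

section \<open>Convergence of the Cauchy kernel\<close>

text \<open>Fekete's argument without logarithms, so that zeros of \<open>b\<close> are allowed. The
  limit is the infimum of the roots: a single root below \<open>d\<close> forces
  \<open>b k \<le> M * d ^ k\<close> for all \<open>k\<close>.\<close>

lemma submultiplicative_root_convergent:
  fixes b :: "nat \<Rightarrow> real"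
  assumes nonneg: "\<And>k. 0 \<le> b k" and submult: "\<And>k m. b (k + m) \<le> b k * b m"
  shows "convergent (\<lambda>k. b k powr (1 / real k))"
proof -
  define r where "r k = b k powr (1 / real k)" for k
  define L where "L = Inf (r ` {1..})"
  have bdd: "bdd_below (r ` {1..})" by (auto intro!: bdd_belowI[where m = 0] simp: r_def)
  have "r \<longlonglongrightarrow> L"
  proof (rule order_tendstoI)
    fix a assume "a < L"
    moreover have "L \<le> r k" if "k \<ge> 1" for k
      unfolding L_def by (rule cInf_lower[OF _ bdd]) (use that in auto)
    ultimately show "\<forall>\<^sub>F k in sequentially. a < r k"
      unfolding eventually_sequentially by (meson less_le_trans)
  next
    fix a assume "L < a"
    then obtain m where m: "m \<ge> 1" "r m < a"
      unfolding L_def using cInf_lessD[of "r ` {1..}" a] by auto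
    \<comment> \<open>The intermediate \<open>d\<close> is positive even if \<open>r m = 0\<close>,
      and leaves room below \<open>a\<close> for the factor coming from \<open>M\<close>.\<close>
    obtain d where d: "r m < d" "d < a" using dense[OF m(2)] by blast
    have d0: "d > 0" using d(1) by (smt (verit) powr_ge_zero r_def)
    have bm: "b m \<le> d ^ m"
    proof (cases "b m = 0")
      case False
      then have "b m = r m ^ m"
        using m(1) nonneg[of m] by (simp add: r_def powr_realpow[symmetric] powr_powr)
      also have "\<dots> \<le> d ^ m" using d(1) by (intro power_mono) (auto simp: r_def)
      finally show ?thesis .
    qed (use d0 in simp)
    \<comment> \<open>Bounds the quotients \<open>b j / d ^ j\<close> for all possible remainders
      \<open>j < m\<close>; the induction removes blocks of length \<open>m\<close>.\<close>
    define M where "M = (\<Sum>j<m. b j / d ^ j) + 1"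
    have M: "M > 0" unfolding M_def using d0 nonneg by (intro add_nonneg_pos sum_nonneg) auto
    have bound: "b k \<le> M * d ^ k" for k
    proof (induction k rule: less_induct)
      case (less k)
      show ?case
      proof (cases "k < m")
        case True
        then have "b k / d ^ k \<le> (\<Sum>j<m. b j / d ^ j)"
          using d0 nonneg by (intro member_le_sum) auto
        then have "b k / d ^ k \<le> M" by (simp add: M_def)
        then show ?thesis using d0 by (simp add: divide_le_eq)
      next
        case False
        then have "b k \<le> b m * b (k - m)" using submult[of m "k - m"] by simp
        also have "\<dots> \<le> d ^ m * (M * d ^ (k - m))"
          using False m(1) bm d0 nonneg by (intro mult_mono less.IH) auto
        also have "\<dots> = M * d ^ k" using False by (simp add: power_add[symmetric])
        finally show ?thesis .
      qed
    qed
    have "(\<lambda>k. M powr (1 / real k) * d) \<longlonglongrightarrow> M powr 0 * d"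
      using M by (intro tendsto_intros lim_1_over_n) auto
    then have "\<forall>\<^sub>F k in sequentially. M powr (1 / real k) * d < a"
      using M d(2) by (intro order_tendstoD(2)) auto
    then show "\<forall>\<^sub>F k in sequentially. r k < a"
      using eventually_gt_at_top[of 0]
    proof eventually_elim
      case (elim k)
      have "r k \<le> (M * d ^ k) powr (1 / real k)"
        unfolding r_def by (intro powr_mono2 bound nonneg) auto
      also have "\<dots> = M powr (1 / real k) * d"
        using M d0 elim(2) by (simp add: powr_mult powr_realpow[symmetric] powr_powr)
      finally show ?case using elim(1) by simp
    qed
  qed
  then show ?thesis unfolding r_def convergent_def by blast
qed

lemma summable_root_test:
  fixes b :: "nat \<Rightarrow> real"
  assumes nonneg: "\<And>k. 0 \<le> b k" and lim: "(\<lambda>k. b k powr (1 / real k)) \<longlonglongrightarrow> r" and r: "r < 1"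
  shows "summable b"
proof -
  obtain s where s: "max r 0 < s" "s < 1" using dense[of "max r 0" 1] r by auto
  have "\<forall>\<^sub>F k in sequentially. b k powr (1 / real k) < s"
    using lim s by (intro order_tendstoD(2)) auto
  then have "\<forall>\<^sub>F k in sequentially. norm (b k) \<le> s ^ k"
    using eventually_gt_at_top[of 0]
  proof eventually_elim
    case (elim k)
    show ?case
    proof (cases "b k = 0")
      case False
      then have "b k = (b k powr (1 / real k)) ^ k"
        using elim(2) nonneg[of k] by (simp add: powr_realpow[symmetric] powr_powr)
      also have "\<dots> \<le> s ^ k" using elim(1) by (intro power_mono) auto
      finally show ?thesis using nonneg[of k] by simp
    qed (use s in simp)
  qed
  then show ?thesis
    by (rule summable_comparison_test_ev) (use s in \<open>auto intro: summable_geometric\<close>)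
qed

section \<open>Row operators and the joint spectral radius\<close>

lemma sum_words_add:
  "(\<Sum>\<gamma> | length (\<gamma> :: 'n::finite list) = k + m. g \<gamma>)
    = (\<Sum>\<alpha> | length \<alpha> = k. \<Sum>\<beta> | length \<beta> = m. g (\<alpha> @ \<beta>))"
  by (induction k arbitrary: g) (simp_all add: sum_words_Suc)

lemma op_word_append: "op_word T (\<alpha> @ \<beta>) = op_word T \<alpha> o\<^sub>L op_word T \<beta>"
  by (induction \<alpha>) (auto intro: blinfun_eqI)

text \<open>The product of the row operator with entries \<open>op_word T \<alpha>\<close> and its
  adjoint column; its norm is the quantity inside the joint spectral radius.\<close>

definition row_square :: "('n::finite \<Rightarrow> 'h::complex_inner \<Rightarrow>\<^sub>L 'h) \<Rightarrow> nat \<Rightarrow> 'h \<Rightarrow>\<^sub>L 'h" where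
  "row_square T k = (\<Sum>\<alpha> | length \<alpha> = k. op_word T \<alpha> o\<^sub>L adj (op_word T \<alpha>))"

context
  fixes T :: "'n::finite \<Rightarrow> 'h::chilbert_space \<Rightarrow>\<^sub>L 'h"
  assumes T: "\<And>i. T i \<in> bounded_ops"
begin

lemma cinner_row_square:
  "cinner (row_square T k x) y = (\<Sum>\<alpha> | length \<alpha> = k. cinner (adj (op_word T \<alpha>) x) (adj (op_word T \<alpha>) y))"
  by (simp add: row_square_def blinfun.sum_left cinner_sum_left adj_exists op_word_bounded_ops T)

text \<open>The sum is the quadratic form of \<open>row_square T k\<close> at
  \<open>x\<close>.\<close>

lemma sum_adj_le: "(\<Sum>\<alpha> | length \<alpha> = k. (norm (adj (op_word T \<alpha>) x))\<^sup>2) \<le> norm (row_square T k) * (norm x)\<^sup>2"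
proof -
  let ?s = "\<Sum>\<alpha> | length \<alpha> = k. (norm (adj (op_word T \<alpha>) x))\<^sup>2"
  have "?s = cmod (complex_of_real ?s)"
    unfolding norm_of_real by (simp add: sum_nonneg)
  also have "complex_of_real ?s = cinner (row_square T k x) x"
    by (simp add: cinner_row_square cinner_self)
  also have "cmod (cinner (row_square T k x) x) \<le> norm (row_square T k x) * norm x" by (rule cauchy_schwarz)
  also have "\<dots> \<le> norm (row_square T k) * norm x * norm x"
    by (intro mult_right_mono norm_blinfun) simp
  finally show ?thesis by (simp add: power2_eq_square mult.assoc)
qed

text \<open>Converse of \<open>sum_adj_le\<close>: a bound on the column bounds row times column.
  The image \<open>z\<close> is paired with itself and Cauchy-Schwarz is applied over the
  words.\<close>

lemma norm_row_square_le:
  assumes c: "c \<ge> 0"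
    and bound: "\<And>x. (\<Sum>\<alpha> | length \<alpha> = k. (norm (adj (op_word T \<alpha>) x))\<^sup>2) \<le> c * (norm x)\<^sup>2"
  shows "norm (row_square T k) \<le> c"
proof (rule norm_blinfun_bound[OF c])
  fix x
  let ?W = "{\<alpha> :: 'n list. length \<alpha> = k}"
  let ?n = "\<lambda>x. L2_set (\<lambda>\<alpha>. norm (adj (op_word T \<alpha>) x)) ?W"
  have n: "?n x \<le> sqrt c * norm x" for x
    using real_sqrt_le_mono[OF bound[of x]] by (simp add: L2_set_def real_sqrt_mult)
  define z where "z = row_square T k x"
  have "complex_of_real ((norm z)\<^sup>2) = (\<Sum>\<alpha>\<in>?W. cinner (adj (op_word T \<alpha>) x) (adj (op_word T \<alpha>) z))"
    unfolding cinner_self[symmetric] z_def cinner_row_square ..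
  then have "(norm z)\<^sup>2 = cmod (\<Sum>\<alpha>\<in>?W. cinner (adj (op_word T \<alpha>) x) (adj (op_word T \<alpha>) z))"
    by (metis norm_of_real abs_of_nonneg zero_le_power2)
  also have "\<dots> \<le> (\<Sum>\<alpha>\<in>?W. \<bar>norm (adj (op_word T \<alpha>) x)\<bar> * \<bar>norm (adj (op_word T \<alpha>) z)\<bar>)"
    by (rule sum_norm_le) (simp add: cauchy_schwarz)
  also have "\<dots> \<le> ?n x * ?n z" by (rule L2_set_mult_ineq)
  also have "\<dots> \<le> (sqrt c * norm x) * (sqrt c * norm z)"
    using n c by (intro mult_mono) auto
  also have "\<dots> = (c * norm x) * norm z" using c by simp
  finally have "norm z * norm z \<le> (c * norm x) * norm z" by (simp add: power2_eq_square)
  then show "norm (row_square T k x) \<le> c * norm x"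
    unfolding z_def[symmetric] using c by (cases "z = 0") auto
qed

text \<open>Adjoints reverse products, so the column of degree \<open>k + m\<close> is the column of
  degree \<open>m\<close> applied to each entry of the column of degree \<open>k\<close>.\<close>

lemma norm_row_square_submult:
  "norm (row_square T (k + m)) \<le> norm (row_square T k) * norm (row_square T m)"
proof (rule norm_row_square_le)
  fix x
  have "(\<Sum>\<alpha> | length \<alpha> = k + m. (norm (adj (op_word T \<alpha>) x))\<^sup>2)
      = (\<Sum>\<alpha> | length \<alpha> = k. \<Sum>\<beta> | length \<beta> = m. (norm (adj (op_word T \<beta>) (adj (op_word T \<alpha>) x)))\<^sup>2)"
    by (simp add: sum_words_add op_word_append adj_compose op_word_bounded_ops T)
  also have "\<dots> \<le> (\<Sum>\<alpha> | length \<alpha> = k. norm (row_square T m) * (norm (adj (op_word T \<alpha>) x))\<^sup>2)"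
    by (intro sum_mono sum_adj_le)
  also have "\<dots> \<le> norm (row_square T m) * (norm (row_square T k) * (norm x)\<^sup>2)"
    unfolding sum_distrib_left[symmetric] by (intro mult_left_mono sum_adj_le) simp
  finally show "(\<Sum>\<alpha> | length \<alpha> = k + m. (norm (adj (op_word T \<alpha>) x))\<^sup>2)
      \<le> norm (row_square T k) * norm (row_square T m) * (norm x)\<^sup>2"
    by (simp add: mult_ac)
qed simp

lemma summable_sqrt_row_square:
  assumes "joint_spectral_radius T < 1"
  shows "summable (\<lambda>k. sqrt (norm (row_square T k)))"
proof -
  let ?b = "\<lambda>k. sqrt (norm (row_square T k))"
  \<comment> \<open>The exponent 1/(2k) is the k-th root of a square root, so the radius is a
    root-test limit for \<open>?b\<close>.\<close>
  have root: "norm (row_square T k) powr (1 / (2 * real k)) = ?b k powr (1 / real k)" for k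
    by (simp add: powr_half_sqrt[symmetric] powr_powr)
  have "convergent (\<lambda>k. ?b k powr (1 / real k))"
    using norm_row_square_submult
    by (intro submultiplicative_root_convergent) (auto simp: real_sqrt_mult[symmetric])
  moreover have "joint_spectral_radius T = lim (\<lambda>k. ?b k powr (1 / real k))"
    unfolding joint_spectral_radius_def row_square_def[symmetric] root ..
  ultimately show ?thesis
    using assms by (intro summable_root_test) (auto simp: convergent_LIMSEQ_iff)
qed

end

section \<open>Column operators and the terms of the Cauchy kernel\<close>

text \<open>In coordinates, this is the sum of the operators \<open>R\<^sub>\<alpha> \<otimes> B\<^sub>\<delta>\<close> over the words \<open>\<delta>\<close> of length \<open>k\<close>,
  with \<open>\<alpha> = rev \<delta>\<close>.\<close>

definition column_coord ::
  "nat \<Rightarrow> ('n list \<Rightarrow> 'h::real_normed_vector \<Rightarrow>\<^sub>L 'h) \<Rightarrow> ('n list \<Rightarrow> 'h) \<Rightarrow> 'n list \<Rightarrow> 'h" where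
  "column_coord k B f \<gamma> =
    (if length \<gamma> < k then 0 else B (drop (length \<gamma> - k) \<gamma>) (f (take (length \<gamma> - k) \<gamma>)))"

definition column_op ::
  "nat \<Rightarrow> ('n list \<Rightarrow> 'h::real_normed_vector \<Rightarrow>\<^sub>L 'h) \<Rightarrow> ('n list, 'h) ell2 \<Rightarrow>\<^sub>L ('n list, 'h) ell2" where
  "column_op k B = Blinfun (\<lambda>f. Abs_ell2 (column_coord k B (ell2_coord f)))"

text \<open>A word is determined by its last \<open>k\<close> letters and the prefix before them.
  Summing over all such pairs, the hypothesis applies for each fixed prefix.\<close>

lemma column_L2_le:
  fixes B :: "'n::finite list \<Rightarrow> 'h::real_normed_vector \<Rightarrow>\<^sub>L 'h"
  assumes c: "c \<ge> 0" and bound: "\<And>x. (\<Sum>\<delta> | length \<delta> = k. (norm (B \<delta> x))\<^sup>2) \<le> c\<^sup>2 * (norm x)\<^sup>2"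
    and F: "finite F"
  shows "L2_set (\<lambda>\<gamma>. norm (column_coord k B (ell2_coord f) \<gamma>)) F \<le> c * norm f"
proof -
  let ?G = "{\<gamma> \<in> F. k \<le> length \<gamma>}"
  let ?p = "\<lambda>\<gamma> :: 'n list. take (length \<gamma> - k) \<gamma>" and ?s = "\<lambda>\<gamma> :: 'n list. drop (length \<gamma> - k) \<gamma>"
  have inj: "inj_on (\<lambda>\<gamma>. (?p \<gamma>, ?s \<gamma>)) ?G"
    by (rule inj_onI) (metis append_take_drop_id prod.inject)
  have "(\<Sum>\<gamma>\<in>F. (norm (column_coord k B (ell2_coord f) \<gamma>))\<^sup>2)
      = (\<Sum>\<gamma>\<in>?G. (norm (B (?s \<gamma>) (ell2_coord f (?p \<gamma>))))\<^sup>2)"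
    by (rule sum.mono_neutral_cong_right) (auto simp: F column_coord_def)
  also have "\<dots> = (\<Sum>(\<beta>, \<delta>)\<in>(\<lambda>\<gamma>. (?p \<gamma>, ?s \<gamma>)) ` ?G. (norm (B \<delta> (ell2_coord f \<beta>)))\<^sup>2)"
    by (subst sum.reindex[OF inj]) simp
  also have "\<dots> \<le> (\<Sum>(\<beta>, \<delta>)\<in>(?p ` ?G) \<times> {\<delta>. length \<delta> = k}. (norm (B \<delta> (ell2_coord f \<beta>)))\<^sup>2)"
    by (rule sum_mono2) (auto simp: F)
  also have "\<dots> = (\<Sum>\<beta>\<in>?p ` ?G. \<Sum>\<delta> | length \<delta> = k. (norm (B \<delta> (ell2_coord f \<beta>)))\<^sup>2)"
    by (simp add: sum.cartesian_product)
  also have "\<dots> \<le> (\<Sum>\<beta>\<in>?p ` ?G. c\<^sup>2 * (norm (ell2_coord f \<beta>))\<^sup>2)"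
    by (intro sum_mono bound)
  also have "\<dots> = c\<^sup>2 * (L2_set (\<lambda>\<beta>. norm (ell2_coord f \<beta>)) (?p ` ?G))\<^sup>2"
    by (simp add: sum_distrib_left L2_set_sq)
  also have "\<dots> \<le> c\<^sup>2 * (norm f)\<^sup>2"
    by (intro mult_left_mono power_mono L2_coord_le) (auto simp: F)
  finally show ?thesis
    unfolding L2_set_def using c by (intro real_le_lsqrt) (auto simp: power_mult_distrib)
qed

lemma column_op_bounds:
  fixes B :: "'n::finite list \<Rightarrow> 'h::real_normed_vector \<Rightarrow>\<^sub>L 'h"
  assumes c: "c \<ge> 0" and bound: "\<And>x. (\<Sum>\<delta> | length \<delta> = k. (norm (B \<delta> x))\<^sup>2) \<le> c\<^sup>2 * (norm x)\<^sup>2"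
  shows "ell2_coord (column_op k B f) = column_coord k B (ell2_coord f)"
    and "norm (column_op k B) \<le> c"
proof -
  let ?g = "\<lambda>f. Abs_ell2 (column_coord k B (ell2_coord f))"
  have g: "ell2_coord (?g f) = column_coord k B (ell2_coord f)" for f
    by (rule ell2_coord_Abs) (rule column_L2_le[OF c bound])
  have gn: "norm (?g f) \<le> c * norm f" for f
    using column_L2_le[OF c bound, of _ f] by (intro norm_ell2_le) (auto simp: g)
  have "bounded_linear ?g"
  proof (rule bounded_linear_intro[where K = c])
    show "?g (f + h) = ?g f + ?g h" for f h
      by (rule ell2_eqI, simp only: g, simp add: g plus_ell2.rep_eq column_coord_def blinfun.add_right)
    show "?g (r *\<^sub>R f) = r *\<^sub>R ?g f" for f r
      by (rule ell2_eqI, simp only: g, simp add: g scaleR_ell2.rep_eq column_coord_def blinfun.scaleR_right)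
    show "norm (?g f) \<le> norm f * c" for f
      using gn[of f] by (simp add: mult.commute)
  qed
  then have eq: "blinfun_apply (column_op k B) = ?g"
    unfolding column_op_def by (rule bounded_linear_Blinfun_apply)
  show "ell2_coord (column_op k B f) = column_coord k B (ell2_coord f)"
    by (simp only: eq g)
  show "norm (column_op k B) \<le> c"
    using c gn by (intro norm_blinfun_bound) (simp_all only: eq)
qed

text \<open>There are finitely many words of length \<open>k\<close>, so the crude constant
  \<open>?c\<close> always bounds the column. Sharper constants matter only for the operator
  norm.\<close>

lemma column_op_coord:
  fixes B :: "'n::finite list \<Rightarrow> 'h::real_normed_vector \<Rightarrow>\<^sub>L 'h"
  shows "ell2_coord (column_op k B f) = column_coord k B (ell2_coord f)"
proof (rule column_op_bounds(1))
  let ?c = "sqrt (\<Sum>\<delta> | length \<delta> = k. (norm (B \<delta>))\<^sup>2)"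
  show "?c \<ge> 0" by (simp add: sum_nonneg)
  fix x
  have "(\<Sum>\<delta> | length \<delta> = k. (norm (B \<delta> x))\<^sup>2) \<le> (\<Sum>\<delta> | length \<delta> = k. (norm (B \<delta>) * norm x)\<^sup>2)"
    by (intro sum_mono power_mono norm_blinfun) simp
  also have "\<dots> = ?c\<^sup>2 * (norm x)\<^sup>2"
    by (simp add: sum_nonneg power_mult_distrib sum_distrib_right)
  finally show "(\<Sum>\<delta> | length \<delta> = k. (norm (B \<delta> x))\<^sup>2) \<le> ?c\<^sup>2 * (norm x)\<^sup>2" .
qed

text \<open>The outermost factor, the first letter of \<alpha>, is appended last; hence \<alpha>
  shows up reversed at the end of the word.\<close>

lemma right_creation_word_coord:
  fixes \<xi> :: "'n::finite fock"
  shows "ell2_coord (op_word right_creation \<alpha> \<xi>) \<gamma> =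
    (if drop (length \<gamma> - length \<alpha>) \<gamma> = rev \<alpha> then ell2_coord \<xi> (take (length \<gamma> - length \<alpha>) \<gamma>) else 0)"
proof (induction \<alpha> arbitrary: \<gamma>)
  case (Cons i \<alpha>)
  show ?case
  proof (cases \<gamma> rule: rev_cases)
    case (snoc \<beta> j)
    have "ell2_coord (op_word right_creation (i # \<alpha>) \<xi>) \<gamma>
        = axis i 1 $ j * ell2_coord (op_word right_creation \<alpha> \<xi>) \<beta>"
      by (simp add: snoc right_creation.rep_eq tensor_right.rep_eq)
    then show ?thesis
      unfolding Cons by (auto simp: snoc axis_def)
  qed (simp add: right_creation.rep_eq tensor_right.rep_eq)
qed simp

lemma op_tensor_right_creation:
  fixes \<alpha> :: "'n::finite list" and B :: "'h::complex_inner \<Rightarrow>\<^sub>L 'h"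
  assumes B: "B \<in> bounded_ops"
  shows "op_tensor (op_word right_creation \<alpha>) B = column_op (length \<alpha>) (\<lambda>\<delta>. if \<delta> = rev \<alpha> then B else 0)"
    (is "_ = ?C")
proof (rule op_tensor_eqI)
  show "?C \<in> bounded_ops"
    unfolding bounded_ops_def
    using B by (auto intro!: ell2_eqI simp: bounded_ops_def column_op_coord column_coord_def scaleC_ell2.rep_eq)
  fix \<xi> :: "'n fock" and x
  show "?C (tensor \<xi> x) = tensor (op_word right_creation \<alpha> \<xi>) (B x)"
  proof (rule ell2_eqI)
    fix \<gamma>
    \<comment> \<open>Natural subtraction truncates at 0 here, so nothing is dropped and \<gamma> is
      too short.\<close>
    have "drop (length \<gamma> - length \<alpha>) \<gamma> \<noteq> rev \<alpha>" if "length \<gamma> < length \<alpha>"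
      using that by (metis length_drop length_rev diff_le_self not_le)
    then show "ell2_coord (?C (tensor \<xi> x)) \<gamma> = ell2_coord (tensor (op_word right_creation \<alpha> \<xi>) (B x)) \<gamma>"
      using B by (auto simp: column_op_coord column_coord_def tensor.rep_eq right_creation_word_coord bounded_ops_def)
  qed
qed

text \<open>The reversal of \<alpha> in the kernel cancels the reversal caused by the right creation
  operators: a suffix \<delta> carries exactly the coefficient
  \<open>adj (op_word T \<delta>)\<close>.\<close>

lemma cauchy_kernel_term:
  fixes T :: "'n::finite \<Rightarrow> 'h::chilbert_space \<Rightarrow>\<^sub>L 'h"
  assumes T: "\<And>i. T i \<in> bounded_ops"
  shows "(\<Sum>\<alpha> | length \<alpha> = k. op_tensor (op_word right_creation \<alpha>) (adj (op_word T (rev \<alpha>))))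
    = column_op k (\<lambda>\<delta>. adj (op_word T \<delta>))"
proof (rule blinfun_eqI, rule ell2_eqI)
  fix f :: "('n list, 'h) ell2" and \<gamma>
  let ?B = "\<lambda>\<delta>. adj (op_word T \<delta>)" and ?W = "{\<alpha> :: 'n list. length \<alpha> = k}"
  have "ell2_coord ((\<Sum>\<alpha>\<in>?W. op_tensor (op_word right_creation \<alpha>) (?B (rev \<alpha>))) f) \<gamma>
      = (\<Sum>\<alpha>\<in>?W. column_coord k (\<lambda>\<delta>. if \<delta> = rev \<alpha> then ?B (rev \<alpha>) else 0) (ell2_coord f) \<gamma>)"
    unfolding blinfun.sum_left ell2_coord_sum
    by (intro sum.cong refl)
      (auto simp: op_tensor_right_creation adj_bounded_ops op_word_bounded_ops T column_op_coord)
  also have "\<dots> = column_coord k ?B (ell2_coord f) \<gamma>"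
  proof (cases "length \<gamma> < k")
    case False
    let ?s = "drop (length \<gamma> - k) \<gamma>" and ?v = "ell2_coord f (take (length \<gamma> - k) \<gamma>)"
    have "(\<Sum>\<alpha>\<in>?W. column_coord k (\<lambda>\<delta>. if \<delta> = rev \<alpha> then ?B (rev \<alpha>) else 0) (ell2_coord f) \<gamma>)
        = (\<Sum>\<alpha>\<in>?W. if \<alpha> = rev ?s then ?B ?s ?v else 0)"
      using False by (intro sum.cong refl) (auto simp: column_coord_def)
    then show ?thesis using False by (simp add: column_coord_def)
  qed (simp add: column_coord_def)
  finally show "ell2_coord ((\<Sum>\<alpha>\<in>?W. op_tensor (op_word right_creation \<alpha>) (?B (rev \<alpha>))) f) \<gamma>
      = ell2_coord (column_op k ?B f) \<gamma>"
    by (simp add: column_op_coord)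
qed

text \<open>Norm convergence lets the coordinate functional pass through the series. The bounds
  \<open>c\<close> are abstract so that one sequence can serve two tuples.\<close>

lemma cauchy_kernel_vacuum_coord:
  fixes T :: "'n::finite \<Rightarrow> 'h::chilbert_space \<Rightarrow>\<^sub>L 'h"
  assumes T: "\<And>i. T i \<in> bounded_ops"
    and c: "\<And>k. c k \<ge> 0" "summable c"
    and bound: "\<And>k x. (\<Sum>\<alpha> | length \<alpha> = k. (norm (adj (op_word T \<alpha>) x))\<^sup>2) \<le> (c k)\<^sup>2 * (norm x)\<^sup>2"
  shows "ell2_coord (cauchy_kernel T (tensor vacuum y)) \<gamma> = adj (op_word T \<gamma>) y"
proof -
  let ?C = "\<lambda>k. column_op k (\<lambda>\<delta>. adj (op_word T \<delta>))"
  let ?e = "\<lambda>C :: ('n list, 'h) ell2 \<Rightarrow>\<^sub>L ('n list, 'h) ell2. ell2_coord (C (tensor vacuum y)) \<gamma>"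
  have "summable ?C"
    by (rule summable_comparison_test[OF _ c(2)])
      (use column_op_bounds(2)[OF c(1) bound] in blast)
  moreover have "bounded_linear ?e"
    by (rule bounded_linear_compose[OF bounded_linear_ell2_coord blinfun.bounded_linear_left])
  ultimately have "?e (suminf ?C) = (\<Sum>k. ?e (?C k))"
    by (rule bounded_linear.suminf[rotated])
  \<comment> \<open>The vacuum lives on the empty word, so the suffix of length \<open>k\<close>
    must be all of \<gamma>.\<close>
  also have "\<dots> = (\<Sum>k. if k = length \<gamma> then adj (op_word T \<gamma>) y else 0)"
    by (rule suminf_cong) (auto simp: column_op_coord column_coord_def tensor.rep_eq vacuum.rep_eq)
  also have "\<dots> = adj (op_word T \<gamma>) y"
    using sums_single[of "length \<gamma>" "\<lambda>_. adj (op_word T \<gamma>) y"] by (simp add: sums_iff)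
  finally show ?thesis by (simp add: cauchy_kernel_def cauchy_kernel_term T)
qed

section \<open>Gauge action on tuples and covariance of the Cauchy transform\<close>

lemma gauge_tuple_bounded_ops:
  assumes "\<And>i. T i \<in> bounded_ops"
  shows "gauge_tuple U T j \<in> bounded_ops"
  unfolding gauge_tuple_def
  by (intro op_subalgebra_sum op_subalgebra_scaleC op_subalgebra_bounded_ops assms)

lemma adj_gauge_tuple:
  fixes T :: "'n::finite \<Rightarrow> 'h::chilbert_space \<Rightarrow>\<^sub>L 'h"
  assumes "\<And>i. T i \<in> bounded_ops"
  shows "adj (gauge_tuple U T j) = (\<Sum>i\<in>UNIV. cnj (U $ i $ j) *\<^sub>C adj (T i))"
  by (rule adj_eqI)
    (simp add: gauge_tuple_def blinfun.sum_left scaleC_blinfun.rep_eq cinner_sum_left cinner_sum_right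
      cinner_scaleC_left cinner_scaleC_right adj_exists assms)

text \<open>The adjoint applies the first letter first, with conjugated coefficients, which is the
  recursion of \<open>word_map (ctrans U)\<close>. The vector \<open>y\<close> varies because the
  induction hypothesis is used at \<open>adj (T j) y\<close>.\<close>

lemma adj_word_gauge_tuple:
  fixes T :: "'n::finite \<Rightarrow> 'h::chilbert_space \<Rightarrow>\<^sub>L 'h"
  assumes T: "\<And>i. T i \<in> bounded_ops"
  shows "adj (op_word (gauge_tuple U T) \<alpha>) y = word_map (ctrans U) (\<lambda>\<beta>. adj (op_word T \<beta>) y) \<alpha>"
proof (induction \<alpha> arbitrary: y)
  case (Cons i \<alpha>)
  note T' = gauge_tuple_bounded_ops[of T U, OF T]
  have "adj (op_word (gauge_tuple U T) \<alpha>) \<in> bounded_ops"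
    by (intro adj_bounded_ops op_word_bounded_ops T')
  then have adj': "adj (op_word (gauge_tuple U T) \<alpha>) (c *\<^sub>C z) = c *\<^sub>C adj (op_word (gauge_tuple U T) \<alpha>) z" for c z
    by (simp add: bounded_ops_def)
  have "adj (op_word (gauge_tuple U T) (i # \<alpha>)) y
      = (\<Sum>j\<in>UNIV. cnj (U $ j $ i) *\<^sub>C adj (op_word (gauge_tuple U T) \<alpha>) (adj (T j) y))"
    by (simp add: adj_compose op_word_bounded_ops T' adj_gauge_tuple T blinfun.sum_left
        blinfun.sum_right scaleC_blinfun.rep_eq adj')
  also have "\<dots> = word_map (ctrans U) (\<lambda>\<beta>. adj (op_word T \<beta>) y) (i # \<alpha>)"
    by (simp add: Cons adj_compose op_word_bounded_ops T)
  finally show ?case .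
qed (simp add: adj_id)

theorem theorem4p7:
  fixes T :: "'n::finite \<Rightarrow> 'h::chilbert_space \<Rightarrow>\<^sub>L 'h"
    and U :: "complex ^ 'n ^ 'n"
    and f :: "'n fock \<Rightarrow>\<^sub>L 'n fock"
  assumes "\<And>i. T i \<in> bounded_ops"
    and "joint_spectral_radius T < 1"
    and "U \<in> unitaries"
    and "f \<in> disc_algebra"
  shows "cauchy_transform T (gauge_automorphism U f) = cauchy_transform (gauge_tuple U T) f"
proof -
  note T = assms(1) and U = assms(3) and f = assms(4)
  note U' = ctrans_unitaries[OF U] and T' = gauge_tuple_bounded_ops[of T U, OF T]
  define c where "c k = sqrt (norm (row_square T k))" for k
  have c: "c k \<ge> 0" "summable c" for k
    using summable_sqrt_row_square[OF T assms(2)] by (simp_all add: c_def[abs_def])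
  have bound: "(\<Sum>\<alpha> | length \<alpha> = k. (norm (adj (op_word T \<alpha>) x))\<^sup>2) \<le> (c k)\<^sup>2 * (norm x)\<^sup>2" for k x
    using sum_adj_le[OF T] by (simp add: c_def)
  \<comment> \<open>In each degree the two columns differ by an isometry, so the same
    \<open>c\<close> controls both kernels.\<close>
  then have bound': "(\<Sum>\<alpha> | length \<alpha> = k. (norm (adj (op_word (gauge_tuple U T) \<alpha>) x))\<^sup>2)
      \<le> (c k)\<^sup>2 * (norm x)\<^sup>2" for k x
    by (simp add: adj_word_gauge_tuple T word_map_norm_sq[OF U'])
  have kernel: "gauge_op (ctrans U) (cauchy_kernel T (tensor vacuum y))
      = cauchy_kernel (gauge_tuple U T) (tensor vacuum y)" for y
  proof (rule ell2_eqI)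
    fix \<alpha>
    have "ell2_coord (cauchy_kernel T (tensor vacuum y)) = (\<lambda>\<beta>. adj (op_word T \<beta>) y)"
      by (rule ext) (rule cauchy_kernel_vacuum_coord[OF T c bound])
    then show "ell2_coord (gauge_op (ctrans U) (cauchy_kernel T (tensor vacuum y))) \<alpha>
        = ell2_coord (cauchy_kernel (gauge_tuple U T) (tensor vacuum y)) \<alpha>"
      by (simp add: gauge_op_coord[OF U'] cauchy_kernel_vacuum_coord[OF T' c bound'] adj_word_gauge_tuple T)
  qed
  have gf: "gauge_conj U f \<in> bounded_ops"
    by (intro disc_algebra_bounded_ops gauge_conj_disc_algebra U f)
  have "cinner (op_tensor (gauge_automorphism U f) id_blinfun (tensor vacuum x)) (cauchy_kernel T (tensor vacuum y))
      = cinner (op_tensor f id_blinfun (tensor vacuum x)) (cauchy_kernel (gauge_tuple U T) (tensor vacuum y))"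
    for x y :: 'h
  proof -
    \<comment> \<open>The inner inverse of \<Gamma> disappears because it fixes the vacuum.\<close>
    have "op_tensor (gauge_automorphism U f) id_blinfun (tensor vacuum x) = gauge_op U (tensor (f vacuum) x)"
      by (simp add: gauge_automorphism_eq[OF U f] op_tensor_id_apply[OF gf] gauge_conj_apply
          gauge_op_vacuum[OF U'] gauge_op_tensor[OF U])
    then show ?thesis
      by (simp add: cinner_gauge_op[OF U] kernel op_tensor_id_apply[OF disc_algebra_bounded_ops[OF f]])
  qed
  \<comment> \<open>The descriptions of the two transforms depend only on these forms and therefore
    coincide.\<close>
  then show ?thesis by (simp add: cauchy_transform_def)
qed

end
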